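(* Any nonsingular toric Fano $3$-fold is F-equivalent to the $3$-dimensional projective space $\mathbf P^3$. In particular, any nonsingular toric Fano $3$-fold is either pseudo-symmetric or F-equivalent to $\mathbf P^3$.
   Context: A nonsingular toric Fano $d$-fold is a nonsingular complete $d$-dimensional toric variety $X$ with $-K_X$ ample; varieties are considered up to isomorphism. Equivariant blow-ups are blow-ups along torus-invariant irreducible closed subvarieties. F-equivalence: two nonsingular toric Fano $d$-folds $X_1,X_2$ are F-equivalent if there exist nonsingular toric Fano $d$-folds $Y_0=X_1,Y_1,\dots,Y_{2l}=X_2$ together with, for each odd $1\le j\le 2l-1$, morphisms $Y_j\to Y_{j-1}$ and $Y_j\to Y_{j+1}$, each a finite (possibly empty) succession of equivariant blow-ups in which all intermediate varieties are nonsingular toric Fano $d$-folds. Pseudo-symmetric: a nonsingular toric Fano $d$-fold with fan $\Sigma$ is pseudo-symmetric if there are two $d$-dimensional cones $\sigma,\sigma'\in\Sigma$ with $\sigma=-\sigma'$. *)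

theory Defs
  imports "HOL-Analysis.Analysis"
begin

text \<open>
  Toric varieties of dimension \<open>d = CARD('n)\<close> are represented by their fans in
  \<open>N \<otimes> \<real>\<close> with \<open>N = \<int>\<^sup>d\<close>; the dual lattice \<open>M\<close> is identified with \<open>N\<close> by the
  standard inner product. Isomorphism, completeness, nonsingularity, ampleness of invariant divisors
  and equivariant blow-ups are rendered by the usual toric dictionary.
\<close>

section \<open>Cones and fans\<close>

definition std_lattice :: "(real^'n) set" where
  "std_lattice = {v. \<forall>i. v $ i \<in> \<int>}"

definition lattice_basis :: "(real^'n) set \<Rightarrow> bool" where
  "lattice_basis B \<longleftrightarrow>
     independent B \<and> {\<Sum>b\<in>B. of_int (c b) *\<^sub>R b | c :: real^'n \<Rightarrow> int. True} = std_lattice"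

definition primitive :: "real^'n \<Rightarrow> bool" where
  "primitive v \<longleftrightarrow> v \<in> std_lattice \<and> v \<noteq> 0 \<and>
     (\<forall>w\<in>std_lattice. \<forall>k::int. v = of_int k *\<^sub>R w \<longrightarrow> \<bar>k\<bar> = 1)"

definition rational_cone :: "(real^'n) set \<Rightarrow> bool" where
  "rational_cone \<sigma> \<longleftrightarrow> (\<exists>S. finite S \<and> S \<subseteq> std_lattice \<and> \<sigma> = convex_cone hull S)"

definition strongly_convex :: "(real^'n) set \<Rightarrow> bool" where
  "strongly_convex \<sigma> \<longleftrightarrow> \<sigma> \<inter> uminus ` \<sigma> = {0}"

text \<open>For a polyhedral cone, the nonempty sets \<open>\<tau>\<close> with \<^term>\<open>\<tau> face_of \<sigma>\<close> are the faces
  \<open>\<sigma> \<inter> m\<^sup>\<bottom>\<close>, \<open>m\<close> in the dual cone, of toric geometry.\<close>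

definition is_fan :: "(real^'n) set set \<Rightarrow> bool" where
  "is_fan \<Sigma> \<longleftrightarrow> finite \<Sigma> \<and> \<Sigma> \<noteq> {} \<and>
     (\<forall>\<sigma>\<in>\<Sigma>. rational_cone \<sigma> \<and> strongly_convex \<sigma>) \<and>
     (\<forall>\<sigma>\<in>\<Sigma>. \<forall>\<tau>. \<tau> face_of \<sigma> \<and> \<tau> \<noteq> {} \<longrightarrow> \<tau> \<in> \<Sigma>) \<and>
     (\<forall>\<sigma>\<in>\<Sigma>. \<forall>\<sigma>'\<in>\<Sigma>. (\<sigma> \<inter> \<sigma>') face_of \<sigma> \<and> (\<sigma> \<inter> \<sigma>') face_of \<sigma>')"

definition complete_fan :: "(real^'n) set set \<Rightarrow> bool" where
  "complete_fan \<Sigma> \<longleftrightarrow> \<Union>\<Sigma> = UNIV"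

definition nonsingular_fan :: "(real^'n) set set \<Rightarrow> bool" where
  "nonsingular_fan \<Sigma> \<longleftrightarrow>
     (\<forall>\<sigma>\<in>\<Sigma>. \<exists>B S. lattice_basis B \<and> S \<subseteq> B \<and> \<sigma> = convex_cone hull S)"

text \<open>Two complete toric varieties are isomorphic iff their fans are related by a
  lattice automorphism.\<close>

definition fan_iso :: "(real^'n) set set \<Rightarrow> (real^'n) set set \<Rightarrow> bool" where
  "fan_iso \<Sigma> \<Sigma>' \<longleftrightarrow>
     (\<exists>f. linear f \<and> bij f \<and> f ` std_lattice = std_lattice \<and> (\<lambda>\<sigma>. f ` \<sigma>) ` \<Sigma> = \<Sigma>')"

definition ray_gens :: "(real^'n) set set \<Rightarrow> (real^'n) set" where
  "ray_gens \<Sigma> = {v. primitive v \<and> convex_cone hull {v} \<in> \<Sigma>}"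


section \<open>Invariant divisors and the Fano condition\<close>

text \<open>A torus-invariant divisor \<open>D\<close>, the sum of the \<open>a\<^sub>\<rho> D\<^sub>\<rho>\<close> over the rays \<open>\<rho>\<close>, is given by its
  coefficient function on primitive ray generators. Its support function takes the value
  \<open>- a\<^sub>\<rho>\<close> at the generator of \<open>\<rho>\<close>; with this sign, ample divisors have concave support functions.\<close>

definition support_function :: "(real^'n) set set \<Rightarrow> (real^'n \<Rightarrow> int) \<Rightarrow> (real^'n \<Rightarrow> real) \<Rightarrow> bool" where
  "support_function \<Sigma> D \<phi> \<longleftrightarrow>
     (\<forall>\<sigma>\<in>\<Sigma>. \<exists>m\<in>std_lattice. \<forall>x\<in>\<sigma>. \<phi> x = m \<bullet> x) \<and>
     (\<forall>v\<in>ray_gens \<Sigma>. \<phi> v = - of_int (D v))"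

text \<open>The usual notion of strict convexity of a support function on a complete fan: distinct
  full-dimensional cones are distinct maximal domains of linearity.\<close>

definition strictly_convex_support :: "(real^'n) set set \<Rightarrow> (real^'n \<Rightarrow> real) \<Rightarrow> bool" where
  "strictly_convex_support \<Sigma> \<phi> \<longleftrightarrow> concave_on UNIV \<phi> \<and>
     (\<forall>\<sigma>\<in>\<Sigma>. dim \<sigma> = CARD('n) \<longrightarrow>
        (\<forall>m. (\<forall>x\<in>\<sigma>. \<phi> x = m \<bullet> x) \<longrightarrow> (\<forall>x. \<phi> x = m \<bullet> x \<longrightarrow> x \<in> \<sigma>)))"

text \<open>Ampleness on a complete toric variety.\<close>

definition ample :: "(real^'n) set set \<Rightarrow> (real^'n \<Rightarrow> int) \<Rightarrow> bool" where
  "ample \<Sigma> D \<longleftrightarrow> (\<exists>\<phi>. support_function \<Sigma> D \<phi> \<and> strictly_convex_support \<Sigma> \<phi>)"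

text \<open>\<open>K\<close> is minus the sum of all prime invariant divisors.\<close>

definition canonical_divisor :: "real^'n \<Rightarrow> int" where
  "canonical_divisor = (\<lambda>_. -1)"

definition nonsingular_toric_fano :: "(real^'n) set set \<Rightarrow> bool" where
  "nonsingular_toric_fano \<Sigma> \<longleftrightarrow>
     is_fan \<Sigma> \<and> complete_fan \<Sigma> \<and> nonsingular_fan \<Sigma> \<and> ample \<Sigma> (\<lambda>v. - canonical_divisor v)"


section \<open>Equivariant blow-ups and F-equivalence\<close>

text \<open>The blow-up of a nonsingular toric variety along the orbit closure \<open>V(\<tau>)\<close> is given by the
  star subdivision at the sum of the primitive generators of \<open>\<tau>\<close>.\<close>

definition star_subdivision :: "(real^'n) set set \<Rightarrow> (real^'n) set \<Rightarrow> (real^'n) set set" where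
  "star_subdivision \<Sigma> \<tau> =
     {\<sigma>\<in>\<Sigma>. \<not> \<tau> \<subseteq> \<sigma>} \<union>
     {convex_cone hull (insert (\<Sum>v\<in>ray_gens \<Sigma> \<inter> \<tau>. v) \<sigma>') | \<sigma>' \<sigma>.
        \<sigma> \<in> \<Sigma> \<and> \<tau> \<subseteq> \<sigma> \<and> \<sigma>' \<in> \<Sigma> \<and> \<sigma>' face_of \<sigma> \<and> \<not> \<tau> \<subseteq> \<sigma>'}"

text \<open>The condition \<open>\<tau> \<noteq> {0}\<close> excludes blowing up the whole variety, the result being empty.
  For one-dimensional \<open>\<tau>\<close> the centre is a divisor and the subdivision is the fan itself.\<close>

definition equivariant_blowup :: "(real^'n) set set \<Rightarrow> (real^'n) set set \<Rightarrow> bool" where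
  "equivariant_blowup Y X \<longleftrightarrow> (\<exists>\<tau>\<in>X. \<tau> \<noteq> {0} \<and> fan_iso Y (star_subdivision X \<tau>))"

text \<open>\<open>fano_blowups Y X\<close>: there is a morphism from \<open>Y\<close> to \<open>X\<close> that is a finite, possibly empty,
  succession of equivariant blow-ups through nonsingular toric Fano varieties.\<close>

inductive fano_blowups :: "(real^'n) set set \<Rightarrow> (real^'n) set set \<Rightarrow> bool" where
  empty: "nonsingular_toric_fano Y \<Longrightarrow> nonsingular_toric_fano X \<Longrightarrow> fan_iso Y X \<Longrightarrow> fano_blowups Y X"
| step: "fano_blowups Z X \<Longrightarrow> nonsingular_toric_fano Y \<Longrightarrow> equivariant_blowup Y Z \<Longrightarrow> fano_blowups Y X"

definition F_equivalent :: "(real^'n) set set \<Rightarrow> (real^'n) set set \<Rightarrow> bool" where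
  "F_equivalent X1 X2 \<longleftrightarrow>
     (\<exists>(l::nat) Y. fan_iso (Y 0) X1 \<and> fan_iso (Y (2 * l)) X2 \<and>
        (\<forall>i\<le>2 * l. nonsingular_toric_fano (Y i)) \<and>
        (\<forall>j. odd j \<and> j < 2 * l \<longrightarrow>
           fano_blowups (Y j) (Y (j - 1)) \<and> fano_blowups (Y j) (Y (j + 1))))"


section \<open>Pseudo-symmetry and projective space\<close>

definition pseudo_symmetric :: "(real^'n) set set \<Rightarrow> bool" where
  "pseudo_symmetric \<Sigma> \<longleftrightarrow> nonsingular_toric_fano \<Sigma> \<and>
     (\<exists>\<sigma>\<in>\<Sigma>. \<exists>\<sigma>'\<in>\<Sigma>. dim \<sigma> = CARD('n) \<and> dim \<sigma>' = CARD('n) \<and> \<sigma> = uminus ` \<sigma>')"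

definition projective_space_gens :: "(real^'n) set" where
  "projective_space_gens = insert (- (\<Sum>i\<in>UNIV. axis i 1)) (range (\<lambda>i. axis i 1))"

definition projective_space_fan :: "(real^'n) set set" where
  "projective_space_fan = {convex_cone hull S | S. S \<subset> projective_space_gens}"

end

theory Submission
  imports Defs
begin

text \<open>
  The fan of a nonsingular toric Fano variety is determined by the lattice bases \<open>S\<close> that generate its maximal
  cones. Let \<open>m\<^sub>S\<close> be the form equal to one on \<open>S\<close>. Ampleness of the anticanonical divisor says that
  \<open>m\<^sub>S \<le> 0\<close> on all other ray generators, and completeness can be replaced by the local condition that each
  ridge lies in two facets: moving across a ridge that separates \<open>S\<close> from a point increases the value of the
  normal at the point, so the facet with the largest value contains the point in its cone. Thus such
  fans correspond to purely combinatorial objects, here called Fano complexes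
  (\<open>nonsingular_toric_fano_fan_of\<close>, \<open>nonsingular_toric_fano_complex\<close>). An equivariant blow-up becomes a
  stellar subdivision of the complex (\<open>star_subdivision_fan_of\<close>), and a blow-up between Fano complexes can be
  used in either direction in a proof of F-equivalence.

  In dimension three the complexes can be enumerated. The sum of all vertices lies in the cone of some facet.
  Take its vertices as the standard basis and let the height of a point be the sum of its
  coordinates. The basis vectors have height one, all other vertices have height at most zero, and the total
  height is nonnegative. So no height is less than \<open>-3\<close>, and the neighbours of the chosen facet bound the
  coordinates; this leaves a short list of possible vertices (\<open>vertex_in_candidates\<close>). Starting from the
  standard facet, a search adds a facet across an unshared ridge, in all ways compatible with convexity and
  total height, until all ridges are shared. A set of facets without unshared ridge is the whole complex
  (\<open>fano_subcomplex_eq\<close>), so every complex is found (\<open>enumeration_sound\<close>).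

  For each complex that the search completes, a move is checked along with it (\<open>enumeration_succeeds\<close>). Either
  the complex is the boundary of the simplex, which gives projective space, or it is the blow-up of a Fano complex with
  fewer vertices, or it is one of four minimal ones, from which a Fano blow-up followed by two blow-downs leads to
  fewer vertices. Induction on the number of vertices finishes the proof.
\<close>

section \<open>Cones over linearly independent sets\<close>

lemma sum_scaleR_in_convex_cone_hull:
  assumes "\<And>v. v \<in> T \<Longrightarrow> 0 \<le> c v" "T \<subseteq> S"
  shows "(\<Sum>v\<in>T. c v *\<^sub>R v) \<in> convex_cone hull S"
proof (cases "finite T")
  case True
  then show ?thesis using assms
  proof (induction T)
    case (insert t T)
    then show ?case
      by (auto intro!: convex_cone_hull_add convex_cone_hull_mul intro: hull_inc)
  qed (simp add: convex_cone_hull_contains_0)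
qed (simp add: convex_cone_hull_contains_0)

lemma convex_cone_nonneg_representation:
  assumes "independent S" "T \<subseteq> S"
  shows "convex_cone {x \<in> span S. (\<forall>v\<in>S. 0 \<le> representation S x v) \<and> (\<forall>v\<in>S - T. representation S x v = 0)}"
  unfolding convex_cone_iff
  by (intro conjI ballI allI impI)
    (use assms in \<open>simp_all add: representation_add representation_scale representation_zero
      span_add span_scale span_zero\<close>)

text \<open>Membership in the cone over a part of an independent set is a condition on coordinates. Faces,
  inclusions and intersections of such cones are read off from this.\<close>

lemma mem_cone_iff_representation:
  fixes S :: "'a::euclidean_space set"
  assumes S: "independent S" and T: "T \<subseteq> S"
  shows "x \<in> convex_cone hull T \<longleftrightarrow>
    x \<in> span S \<and> (\<forall>v\<in>S. 0 \<le> representation S x v) \<and> (\<forall>v\<in>S - T. representation S x v = 0)"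
    (is "_ \<longleftrightarrow> ?R x")
proof
  have "convex_cone hull T \<subseteq> {x. ?R x}"
    using convex_cone_nonneg_representation[OF assms] T S
    by (intro hull_minimal) (auto simp: representation_basis span_base)
  then show "x \<in> convex_cone hull T \<Longrightarrow> ?R x" by auto
next
  assume R: "?R x"
  have fin: "finite S" using S by (rule independent_imp_finite)
  have "x = (\<Sum>v\<in>S. representation S x v *\<^sub>R v)"
    using sum_representation_eq[OF S _ fin] R by auto
  also have "\<dots> = (\<Sum>v\<in>T. representation S x v *\<^sub>R v)"
    using R T fin by (intro sum.mono_neutral_right) auto
  finally show "x \<in> convex_cone hull T"
    using sum_scaleR_in_convex_cone_hull[of T "representation S x" T] R T by auto
qed

lemma cone_Int_independent:
  fixes S :: "'a::euclidean_space set"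
  assumes "independent S" "T \<subseteq> S" "U \<subseteq> S"
  shows "convex_cone hull T \<inter> convex_cone hull U = convex_cone hull (T \<inter> U)"
proof -
  have "T \<inter> U \<subseteq> S" using assms by auto
  then show ?thesis
    using assms by (auto simp: mem_cone_iff_representation[OF assms(1)])
qed

lemma functional_with_values:
  fixes S :: "'a::euclidean_space set"
  assumes "independent S"
  obtains m where "\<And>v. v \<in> S \<Longrightarrow> m \<bullet> v = f v"
proof -
  obtain g :: "'a \<Rightarrow> real" where "linear g" "\<forall>v\<in>S. g v = f v"
    using linear_independent_extend[OF assms] by blast
  then have "\<And>v. v \<in> S \<Longrightarrow> adjoint g 1 \<bullet> v = f v"
    using adjoint_works[of g _ 1] by (simp add: inner_commute)
  then show ?thesis using that by blast
qed

lemma inner_eq_sum_representation: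
  fixes S :: "'a::euclidean_space set"
  assumes "independent S" "x \<in> span S"
  shows "m \<bullet> x = (\<Sum>v\<in>S. representation S x v * (m \<bullet> v))"
proof -
  have "m \<bullet> (\<Sum>v\<in>S. representation S x v *\<^sub>R v) = (\<Sum>v\<in>S. representation S x v * (m \<bullet> v))"
    by (simp add: inner_sum_right)
  then show ?thesis
    using sum_representation_eq[OF assms _ order.refl] independent_imp_finite[OF assms(1)] by simp
qed

lemma cone_face_of_cone:
  fixes S :: "'a::euclidean_space set"
  assumes S: "independent S" and T: "T \<subseteq> S"
  shows "convex_cone hull T face_of convex_cone hull S"
proof -
  \<comment> \<open>The hyperplane on which this form vanishes supports the cone over \<open>S\<close> exactly along the cone over \<open>T\<close>.\<close>
  obtain m where m: "\<And>v. v \<in> S \<Longrightarrow> m \<bullet> v = (if v \<in> T then 0 else 1)"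
    using functional_with_values[OF S, of "\<lambda>v. if v \<in> T then 0 else 1"] by blast
  have mx: "m \<bullet> x = (\<Sum>v\<in>S-T. representation S x v)" if "x \<in> span S" for x
  proof -
    have "m \<bullet> x = (\<Sum>v\<in>S. representation S x v * (m \<bullet> v))"
      by (rule inner_eq_sum_representation[OF S that])
    also have "\<dots> = (\<Sum>v\<in>S-T. representation S x v * (m \<bullet> v))"
      using m T independent_imp_finite[OF S] by (intro sum.mono_neutral_right) auto
    also have "\<dots> = (\<Sum>v\<in>S-T. representation S x v)"
      using m by (intro sum.cong) auto
    finally show ?thesis .
  qed
  have "convex_cone hull T = convex_cone hull S \<inter> {x. m \<bullet> x = 0}"
  proof (rule set_eqI)
    fix x
    have key: "m \<bullet> x = 0 \<longleftrightarrow> (\<forall>v\<in>S-T. representation S x v = 0)"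
      if "x \<in> span S" "\<forall>v\<in>S. 0 \<le> representation S x v"
      unfolding mx[OF that(1)] using that independent_imp_finite[OF S]
      by (intro sum_nonneg_eq_0_iff) auto
    show "x \<in> convex_cone hull T \<longleftrightarrow> x \<in> convex_cone hull S \<inter> {x. m \<bullet> x = 0}"
      unfolding Int_iff mem_Collect_eq mem_cone_iff_representation[OF S T]
        mem_cone_iff_representation[OF S order.refl]
      using key by blast
  qed
  moreover have "0 \<le> m \<bullet> x" if "x \<in> convex_cone hull S" for x
    using that mx[of x] by (auto simp: mem_cone_iff_representation[OF S order.refl] intro!: sum_nonneg)
  ultimately show ?thesis
    using face_of_Int_supporting_hyperplane_ge[of "convex_cone hull S" 0 m]
    by (simp add: convex_convex_cone_hull)
qed

text \<open>A nonzero point of a face lies in the open segment between any other multiple of itself and some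
  further multiple on the opposite side, so a face of a cone is closed under nonnegative scaling.\<close>

lemma face_of_cone_scale:
  fixes S :: "'a::real_vector set"
  assumes face: "\<tau> face_of convex_cone hull S" and z: "z \<in> \<tau>" and k: "0 \<le> k"
  shows "k *\<^sub>R z \<in> \<tau>"
proof (cases "k = 1 \<or> z = 0")
  case False
  have zS: "z \<in> convex_cone hull S" using face z face_of_imp_subset by blast
  have "\<exists>b u. k \<noteq> b \<and> 0 \<le> b \<and> 0 < u \<and> u < 1 \<and> 1 = (1 - u) * k + u * b"
  proof (cases "k < 1")
    case True
    then show ?thesis using k
      by (intro exI[of _ "2 - k"] exI[of _ "1/2"]) (auto simp: field_simps)
  next
    case F: False
    then show ?thesis using False
      by (intro exI[of _ 0] exI[of _ "(k-1)/k"]) (auto simp: field_simps)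
  qed
  then obtain b u where b: "k \<noteq> b" "0 \<le> b" "0 < u" "u < 1" "1 = (1 - u) * k + u * b" by blast
  have "z = ((1 - u) * k + u * b) *\<^sub>R z" using b by simp
  then have "z = (1 - u) *\<^sub>R (k *\<^sub>R z) + u *\<^sub>R (b *\<^sub>R z)"
    by (simp add: scaleR_add_left)
  then have "z \<in> open_segment (k *\<^sub>R z) (b *\<^sub>R z)"
    using b False by (auto simp: in_segment)
  then show ?thesis
    using face_ofD[OF face _ _ _ z] convex_cone_hull_mul zS b k by blast
qed (use z in auto)

lemma convex_cone_face:
  fixes S :: "'a::real_vector set"
  assumes face: "\<tau> face_of convex_cone hull S" and ne: "\<tau> \<noteq> {}"
  shows "convex_cone \<tau>"
  using assms face_of_cone_scale[OF face] face_of_imp_convex[OF face]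
  by (auto simp: convex_cone_def conic_def)

text \<open>If a face contains a sum of two points of the cone then it contains their midpoint, hence
  both points.\<close>

lemma face_of_cone_summand:
  fixes S :: "'a::real_vector set"
  assumes face: "\<tau> face_of convex_cone hull S"
    and xy: "x \<in> convex_cone hull S" "y \<in> convex_cone hull S" and sum: "x + y \<in> \<tau>"
  shows "x \<in> \<tau>"
proof (cases "x = y")
  case True
  then show ?thesis
    using face_of_cone_scale[OF face sum, of "1/2"] by (simp add: scaleR_2[symmetric])
next
  case False
  have "(1/2) *\<^sub>R (x + y) \<in> \<tau>" by (rule face_of_cone_scale[OF face sum]) simp
  moreover have "(1/2) *\<^sub>R (x + y) \<in> open_segment x y"
    using False by (auto simp: in_segment scaleR_add_right intro!: exI[of _ "1/2"])
  ultimately show ?thesis using face_ofD[OF face] xy by blast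
qed

text \<open>By the preceding lemma a point of the face has all its nonzero components
  \<open>representation S x v *\<^sub>R v\<close> in the face.\<close>

lemma face_of_cone_eq:
  fixes S :: "'a::euclidean_space set"
  assumes S: "independent S" and face: "\<tau> face_of convex_cone hull S" and ne: "\<tau> \<noteq> {}"
  shows "\<tau> = convex_cone hull (S \<inter> \<tau>)"
proof
  have fin: "finite S" by (rule independent_imp_finite[OF S])
  show "\<tau> \<subseteq> convex_cone hull (S \<inter> \<tau>)"
  proof
    fix x assume x: "x \<in> \<tau>"
    then have xS: "x \<in> convex_cone hull S" using face face_of_imp_subset by blast
    then have r: "x \<in> span S" "\<forall>v\<in>S. 0 \<le> representation S x v"
      by (auto simp: mem_cone_iff_representation[OF S order.refl])
    have "representation S x v = 0" if v: "v \<in> S - S \<inter> \<tau>" for v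
    proof (rule ccontr)
      let ?c = "representation S x v"
      assume "?c \<noteq> 0"
      then have c: "0 < ?c" using v r by (auto simp: less_le)
      have "x = ?c *\<^sub>R v + (\<Sum>w\<in>S-{v}. representation S x w *\<^sub>R w)"
        using sum_representation_eq[OF S r(1) fin order.refl] v fin
        by (subst sum.remove[symmetric]) auto
      then have "?c *\<^sub>R v + (\<Sum>w\<in>S-{v}. representation S x w *\<^sub>R w) \<in> \<tau>"
        using x by simp
      moreover have "?c *\<^sub>R v \<in> convex_cone hull S"
        using c v by (auto intro: convex_cone_hull_mul hull_inc)
      moreover have "(\<Sum>w\<in>S-{v}. representation S x w *\<^sub>R w) \<in> convex_cone hull S"
        using r by (intro sum_scaleR_in_convex_cone_hull) auto
      ultimately have "?c *\<^sub>R v \<in> \<tau>" using face_of_cone_summand[OF face] by blast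
      then show False using face_of_cone_scale[OF face, of _ "1 / ?c"] c v by fastforce
    qed
    then show "x \<in> convex_cone hull (S \<inter> \<tau>)"
      using r mem_cone_iff_representation[OF S, of "S \<inter> \<tau>" x] by auto
  qed
  show "convex_cone hull (S \<inter> \<tau>) \<subseteq> \<tau>"
    using convex_cone_face[OF face ne] by (intro hull_minimal) auto
qed

section \<open>Lattice bases\<close>

lemma std_lattice_sum:
  assumes "\<And>v. v \<in> A \<Longrightarrow> h v \<in> std_lattice" "\<And>v. v \<in> A \<Longrightarrow> c v \<in> \<int>"
  shows "(\<Sum>v\<in>A. c v *\<^sub>R h v) \<in> std_lattice"
  using assms by (auto simp: std_lattice_def intro!: Ints_sum Ints_mult)

lemma lattice_basis_independent: "lattice_basis B \<Longrightarrow> independent B"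
  by (simp add: lattice_basis_def)

lemma lattice_basis_finite: "lattice_basis B \<Longrightarrow> finite B"
  by (simp add: lattice_basis_def independent_imp_finite)

lemma lattice_basis_coefficients:
  assumes "lattice_basis B" "x \<in> std_lattice"
  obtains c :: "_ \<Rightarrow> int" where "x = (\<Sum>b\<in>B. of_int (c b) *\<^sub>R b)"
proof -
  have "x \<in> {\<Sum>b\<in>B. of_int (c b) *\<^sub>R b | c :: _ \<Rightarrow> int. True}"
    using assms by (simp add: lattice_basis_def)
  then show ?thesis using that by auto
qed

lemma lattice_basis_subset:
  fixes B :: "(real^'n) set"
  assumes "lattice_basis B"
  shows "B \<subseteq> std_lattice"
proof
  fix s assume s: "s \<in> B"
  have "s = (\<Sum>v\<in>B. of_int (if v = s then 1 else 0) *\<^sub>R v)"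
    using s lattice_basis_finite[OF assms]
    by (simp add: if_distrib[of of_int] if_distrib[of "\<lambda>x. x *\<^sub>R _"] cong: if_cong)
  then have "s \<in> {\<Sum>b\<in>B. of_int (c b) *\<^sub>R b | c :: real^'n \<Rightarrow> int. True}"
    by (intro CollectI exI[of _ "\<lambda>v. if v = s then 1 else 0"]) simp
  moreover have "{\<Sum>b\<in>B. of_int (c b) *\<^sub>R b | c :: real^'n \<Rightarrow> int. True} = std_lattice"
    using assms unfolding lattice_basis_def by (rule conjunct2)
  ultimately show "s \<in> std_lattice" by (rule back_subst[of "\<lambda>A. s \<in> A"])
qed

lemma axis_in_std_lattice: "axis i 1 \<in> std_lattice"
  by (auto simp: std_lattice_def axis_def)

lemma lattice_basis_span:
  fixes B :: "(real^'n) set"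
  assumes B: "lattice_basis B"
  shows "span B = UNIV"
proof -
  have "axis i 1 \<in> span B" for i :: 'n
  proof -
    obtain c :: "_ \<Rightarrow> int" where c: "axis i (1::real) = (\<Sum>b\<in>B. of_int (c b) *\<^sub>R b)"
      by (rule lattice_basis_coefficients[OF B axis_in_std_lattice])
    show ?thesis unfolding c by (intro span_sum span_scale span_base)
  qed
  then have "Basis \<subseteq> span B" by (auto simp: Basis_vec_def)
  then show ?thesis by (metis span_Basis span_mono span_span top.extremum_uniqueI)
qed

lemma lattice_basis_card:
  fixes B :: "(real^'n) set"
  assumes "lattice_basis B"
  shows "card B = CARD('n)"
  using dim_eq_card[of B UNIV] lattice_basis_span[OF assms] lattice_basis_independent[OF assms] by simp

lemma lattice_basis_representation_int:
  assumes B: "lattice_basis B" and x: "x \<in> std_lattice"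
  shows "representation B x b \<in> \<int>"
proof (cases "b \<in> B")
  case True
  obtain c :: "_ \<Rightarrow> int" where c: "x = (\<Sum>b\<in>B. of_int (c b) *\<^sub>R b)"
    by (rule lattice_basis_coefficients[OF B x])
  have "representation B x b = (\<Sum>v\<in>B. representation B (of_int (c v) *\<^sub>R v) b)"
    unfolding c using lattice_basis_independent[OF B]
    by (subst representation_sum) (auto intro: span_scale span_base)
  also have "\<dots> = (\<Sum>v\<in>B. of_int (c v) * (if b = v then 1 else 0))"
    using lattice_basis_independent[OF B]
    by (intro sum.cong) (auto simp: representation_scale span_base representation_basis)
  also have "\<dots> \<in> \<int>" by (intro Ints_sum) auto
  finally show ?thesis .
next
  case False
  then show ?thesis by (metis Ints_0 representation_ne_zero)
qed

lemma lattice_basis_primitive: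
  assumes B: "lattice_basis B" and b: "b \<in> B"
  shows "primitive b"
  unfolding primitive_def
proof (intro conjI ballI allI impI)
  show "b \<in> std_lattice" using lattice_basis_subset[OF B] b by auto
  show "b \<noteq> 0" using lattice_basis_independent[OF B] b dependent_zero by blast
  fix w and k :: int assume w: "w \<in> std_lattice" and bk: "b = of_int k *\<^sub>R w"
  have "1 = representation B b b"
    using lattice_basis_independent[OF B] b by (simp add: representation_basis)
  also have "\<dots> = of_int k * representation B w b"
    unfolding bk using lattice_basis_independent[OF B] lattice_basis_span[OF B]
    by (simp add: representation_scale)
  finally have *: "1 = of_int k * representation B w b" .
  obtain j where "representation B w b = of_int j"
    using lattice_basis_representation_int[OF B w] Ints_cases by blast
  then have "k * j = 1" using * by (metis of_int_eq_1_iff of_int_mult)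
  then show "\<bar>k\<bar> = 1" by (auto simp: zmult_eq_1_iff)
qed

lemma primitive_on_ray_unique:
  assumes v: "primitive v" and w: "primitive w" and vw: "v = c *\<^sub>R w" "0 \<le> c" "c \<in> \<int>"
  shows "v = w"
proof -
  obtain k where k: "c = of_int k" using vw(3) Ints_cases by blast
  have "\<bar>k\<bar> = 1" using v w vw(1) unfolding k primitive_def by blast
  then show ?thesis using k vw by auto
qed

text \<open>The integral linear form equal to one on a lattice basis; its level set is the affine
  hyperplane through the basis.\<close>

definition facet_normal :: "(real^'n) set \<Rightarrow> real^'n" where
  "facet_normal S = (SOME m. \<forall>v\<in>S. m \<bullet> v = 1)"

lemma facet_normal_eq_1:
  assumes "lattice_basis S" "v \<in> S"
  shows "facet_normal S \<bullet> v = 1"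
proof -
  obtain m where "\<And>v. v \<in> S \<Longrightarrow> m \<bullet> v = 1"
    using functional_with_values[OF lattice_basis_independent[OF assms(1)], where f = "\<lambda>_. 1"] by metis
  then have "\<exists>m. \<forall>v\<in>S. m \<bullet> v = 1" by blast
  then have "\<forall>v\<in>S. facet_normal S \<bullet> v = 1" unfolding facet_normal_def by (rule someI_ex)
  then show ?thesis using assms(2) by blast
qed

lemma facet_normal_inner:
  assumes S: "lattice_basis S"
  shows "facet_normal S \<bullet> x = (\<Sum>v\<in>S. representation S x v)"
proof -
  have "facet_normal S \<bullet> x = (\<Sum>v\<in>S. representation S x v * (facet_normal S \<bullet> v))"
    by (rule inner_eq_sum_representation[OF lattice_basis_independent[OF S]])
      (simp add: lattice_basis_span[OF S])
  also have "\<dots> = (\<Sum>v\<in>S. representation S x v)"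
    by (intro sum.cong) (auto simp: facet_normal_eq_1[OF S])
  finally show ?thesis .
qed

lemma facet_normal_unique:
  assumes S: "lattice_basis S" and m: "\<And>v. v \<in> S \<Longrightarrow> m \<bullet> v = 1"
  shows "m = facet_normal S"
proof -
  have "m \<bullet> x = facet_normal S \<bullet> x" for x
    using inner_eq_sum_representation[OF lattice_basis_independent[OF S], of x m] lattice_basis_span[OF S] m
    by (simp add: facet_normal_inner[OF S])
  then show ?thesis by (metis inner_commute vector_eq_rdot)
qed

lemma facet_normal_int:
  "lattice_basis S \<Longrightarrow> x \<in> std_lattice \<Longrightarrow> facet_normal S \<bullet> x \<in> \<int>"
  by (simp add: facet_normal_inner lattice_basis_representation_int Ints_sum)

lemma facet_normal_in_lattice: 
  assumes "lattice_basis S"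
  shows "facet_normal S \<in> std_lattice"
  using facet_normal_int[OF assms axis_in_std_lattice] by (auto simp: std_lattice_def inner_axis)

lemma mem_cone_lattice_basis_iff:
  assumes S: "lattice_basis S"
  shows "x \<in> convex_cone hull S \<longleftrightarrow> (\<forall>v\<in>S. 0 \<le> representation S x v)"
  by (simp add: mem_cone_iff_representation[OF lattice_basis_independent[OF S] order.refl]
      lattice_basis_span[OF S])

text \<open>The dimension of a cone is at most the number of its generators.\<close>

lemma sub_basis_eq_of_dim:
  fixes B :: "(real^'n) set"
  assumes B: "lattice_basis B" "T \<subseteq> B" and dim: "dim (convex_cone hull T) = CARD('n)"
  shows "T = B"
proof -
  have fin: "finite T" using B lattice_basis_finite finite_subset by blast
  have "convex_cone hull T \<subseteq> span T" by (intro hull_minimal span_superset convex_cone_span)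
  then have "CARD('n) \<le> card T" using dim fin by (metis dim_le_card)
  then show ?thesis using lattice_basis_card[OF B(1)] lattice_basis_finite[OF B(1)] B(2)
    by (metis card_seteq)
qed

section \<open>Fano complexes and their fans\<close>

text \<open>The boundary complex of a smooth Fano polytope, given by the vertex sets of its facets. Convexity is
  expressed facet by facet; for lattice points the strict inequality \<open>facet_normal S \<bullet> v < 1\<close> away from
  the facet is the same as \<open>facet_normal S \<bullet> v \<le> 0\<close>, because the normal is integral. The last
  condition replaces completeness: every ridge lies in a second facet.\<close>

definition fano_complex :: "(real^'n) set set \<Rightarrow> bool" where
  "fano_complex K \<longleftrightarrow> finite K \<and> K \<noteq> {} \<and> (\<forall>S\<in>K. lattice_basis S) \<and>
     (\<forall>S\<in>K. \<forall>v\<in>\<Union>K - S. facet_normal S \<bullet> v \<le> 0) \<and>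
     (\<forall>S\<in>K. \<forall>v\<in>S. \<exists>S'\<in>K. S \<inter> S' = S - {v})"

definition fan_of :: "(real^'n) set set \<Rightarrow> (real^'n) set set" where
  "fan_of K = {convex_cone hull T | T S. T \<subseteq> S \<and> S \<in> K}"

lemma convex_cone_hull_singleton: "convex_cone hull {v} = {c *\<^sub>R v | c. 0 \<le> c}"
  by (rule hull_unique)
    (auto simp: convex_cone_iff scaleR_add_left[symmetric] intro: exI[of _ 1] exI[of _ 0])

lemma ray_generator_of_cone:
  assumes B: "lattice_basis B" "T \<subseteq> B" and u: "primitive u" "convex_cone hull {u} = convex_cone hull T"
  shows "T = {u}"
proof -
  have iB: "independent B" by (rule lattice_basis_independent[OF B(1)])
  have "t = u" if t: "t \<in> T" for t
  proof -
    have "t \<in> convex_cone hull {u}" using t u(2) by (simp add: hull_inc)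
    then obtain c where c: "t = c *\<^sub>R u" "0 \<le> c" by (auto simp: convex_cone_hull_singleton)
    have tB: "t \<in> B" using t B by auto
    then have "t \<noteq> 0" using iB dependent_zero by blast
    then have ut: "u = (1/c) *\<^sub>R t" using c by auto
    have "representation B u t = 1/c"
      unfolding ut using tB iB by (subst representation_scale) (auto simp: representation_basis span_base)
    moreover have "u \<in> std_lattice" using u(1) by (simp add: primitive_def)
    ultimately have "1/c \<in> \<int>"
      using lattice_basis_representation_int[OF B(1)] by metis
    moreover have "0 \<le> 1/c" using c by simp
    ultimately show "t = u"
      using primitive_on_ray_unique[OF u(1) lattice_basis_primitive[OF B(1) tB] ut] by blast
  qed
  moreover have "T \<noteq> {}"
  proof
    assume "T = {}"
    then have "u \<in> {0}" using u(2) hull_inc[of u "{u}" convex_cone] by simp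
    then show False using u(1) by (simp add: primitive_def)
  qed
  ultimately show ?thesis by blast
qed

lemma fan_ofI: "T \<subseteq> S \<Longrightarrow> S \<in> K \<Longrightarrow> convex_cone hull T \<in> fan_of K"
  unfolding fan_of_def by blast

lemma fan_ofE:
  assumes "\<sigma> \<in> fan_of K"
  obtains T S where "T \<subseteq> S" "S \<in> K" "\<sigma> = convex_cone hull T"
  using assms unfolding fan_of_def by blast

context
  fixes K :: "(real^'n) set set"
  assumes K: "fano_complex K"
begin

lemma complex_finite: "finite K" and complex_nonempty: "K \<noteq> {}"
  and complex_basis: "S \<in> K \<Longrightarrow> lattice_basis S"
  and complex_normal_le_0: "S \<in> K \<Longrightarrow> v \<in> \<Union>K \<Longrightarrow> v \<notin> S \<Longrightarrow> facet_normal S \<bullet> v \<le> 0"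
  using K unfolding fano_complex_def by blast+

lemma complex_neighbour:
  assumes "S \<in> K" "v \<in> S"
  obtains S' where "S' \<in> K" "S \<inter> S' = S - {v}"
  using assms K unfolding fano_complex_def by blast

lemma complex_independent: "S \<in> K \<Longrightarrow> independent S"
  using complex_basis lattice_basis_independent by blast

lemma complex_vertices_finite: "finite (\<Union>K)"
  using complex_finite complex_basis lattice_basis_finite by blast

lemma complex_normal_eq_1: "S \<in> K \<Longrightarrow> v \<in> S \<Longrightarrow> facet_normal S \<bullet> v = 1"
  using complex_basis facet_normal_eq_1 by blast

lemma complex_normal_le_1: "S \<in> K \<Longrightarrow> v \<in> \<Union>K \<Longrightarrow> facet_normal S \<bullet> v \<le> 1"
  using complex_normal_le_0[of S v] complex_normal_eq_1[of S v] by (cases "v \<in> S") auto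

text \<open>A point with a negative coordinate at a vertex of a facet gets a larger value from the
  normal of the facet on the other side of the opposite ridge. So a facet with maximal value at a
  point contains the point in its cone.\<close>

lemma mem_cone_if_normal_maximal:
  assumes S: "S \<in> K" and max: "\<And>S'. S' \<in> K \<Longrightarrow> facet_normal S' \<bullet> x \<le> facet_normal S \<bullet> x"
  shows "x \<in> convex_cone hull S"
proof (rule ccontr)
  let ?r = "representation S x"
  assume "x \<notin> convex_cone hull S"
  then obtain v where v: "v \<in> S" "?r v < 0"
    using mem_cone_lattice_basis_iff[OF complex_basis[OF S], of x] by force
  obtain S' where S': "S' \<in> K" "S \<inter> S' = S - {v}" using complex_neighbour[OF S v(1)] by blast
  let ?m = "facet_normal S'"
  have "v \<notin> S'" using S' v by blast
  then have mv: "?m \<bullet> v \<le> 0" using complex_normal_le_0 S S' v by blast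
  have fin: "finite S" using S complex_basis lattice_basis_finite by blast
  have "?m \<bullet> x = (\<Sum>w\<in>S. ?r w * (?m \<bullet> w))"
    by (rule inner_eq_sum_representation[OF complex_independent[OF S]])
      (simp add: lattice_basis_span[OF complex_basis[OF S]])
  also have "\<dots> = ?r v * (?m \<bullet> v) + (\<Sum>w\<in>S-{v}. ?r w * (?m \<bullet> w))"
    using v(1) fin by (simp add: sum.remove)
  also have "(\<Sum>w\<in>S-{v}. ?r w * (?m \<bullet> w)) = (\<Sum>w\<in>S-{v}. ?r w)"
    using complex_normal_eq_1 S' by (intro sum.cong) auto
  finally have "?m \<bullet> x - facet_normal S \<bullet> x = ?r v * (?m \<bullet> v - 1)"
    using v(1) fin by (simp add: facet_normal_inner[OF complex_basis[OF S]] sum.remove algebra_simps)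
  moreover have "?r v * (?m \<bullet> v - 1) > 0" using v(2) mv by (intro mult_neg_neg) auto
  ultimately show False using max[OF S'(1)] by linarith
qed

lemma complex_normal_max_on_cone:
  assumes S: "S \<in> K" and x: "x \<in> convex_cone hull S" and S': "S' \<in> K"
  shows "facet_normal S' \<bullet> x \<le> facet_normal S \<bullet> x"
proof -
  have "facet_normal S' \<bullet> x = (\<Sum>w\<in>S. representation S x w * (facet_normal S' \<bullet> w))"
    by (rule inner_eq_sum_representation[OF complex_independent[OF S]])
      (simp add: lattice_basis_span[OF complex_basis[OF S]])
  also have "\<dots> \<le> (\<Sum>w\<in>S. representation S x w * 1)"
    using x S complex_normal_le_1[OF S']
    by (intro sum_mono mult_left_mono)
      (auto simp: mem_cone_lattice_basis_iff[OF complex_basis[OF S]])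
  finally show ?thesis by (simp add: facet_normal_inner[OF complex_basis[OF S]])
qed

lemma complex_normal_maximal_facet:
  obtains S where "S \<in> K" "\<And>S'. S' \<in> K \<Longrightarrow> facet_normal S' \<bullet> x \<le> facet_normal S \<bullet> x"
proof -
  let ?f = "\<lambda>S. facet_normal S \<bullet> x"
  have "Max (?f ` K) \<in> ?f ` K" using complex_finite complex_nonempty by (intro Max_in) auto
  then obtain S where "S \<in> K" "?f S = Max (?f ` K)" by auto
  then show ?thesis using that complex_finite by (metis Max_ge finite_imageI imageI)
qed

lemma complex_covers:
  obtains S where "S \<in> K" "x \<in> convex_cone hull S"
  using complex_normal_maximal_facet mem_cone_if_normal_maximal by metis

lemma complex_normal_nonneg_on_cone:
  assumes "S \<in> K" "x \<in> convex_cone hull S"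
  shows "0 \<le> facet_normal S \<bullet> x"
  using assms by (auto simp: facet_normal_inner complex_basis mem_cone_lattice_basis_iff intro!: sum_nonneg)

text \<open>In a common point of two cones both normals take the same value, which forces the support of
  the point into the common vertices.\<close>

lemma complex_cone_Int_facet:
  assumes S: "S \<in> K" and S': "S' \<in> K" and T: "T \<subseteq> S"
    and x: "x \<in> convex_cone hull T" "x \<in> convex_cone hull S'"
  shows "x \<in> convex_cone hull (T \<inter> S')"
proof -
  let ?r = "representation S x"
  note iS = complex_independent[OF S]
  have r: "\<forall>v\<in>S. 0 \<le> ?r v" "\<forall>v\<in>S-T. ?r v = 0" 
    using x(1) by (simp_all add: mem_cone_iff_representation[OF iS T])
  have xS: "x \<in> convex_cone hull S" using x(1) hull_mono[OF T] by blast
  have "facet_normal S \<bullet> x = facet_normal S' \<bullet> x"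
    using complex_normal_max_on_cone[OF S xS S'] complex_normal_max_on_cone[OF S' x(2) S] by simp
  also have "\<dots> = (\<Sum>w\<in>S. ?r w * (facet_normal S' \<bullet> w))"
    by (rule inner_eq_sum_representation[OF iS])
      (simp add: lattice_basis_span[OF complex_basis[OF S]])
  finally have "(\<Sum>w\<in>S. ?r w * (1 - facet_normal S' \<bullet> w)) = 0"
    by (simp add: facet_normal_inner[OF complex_basis[OF S]] right_diff_distrib sum_subtractf)
  moreover have "0 \<le> ?r w * (1 - facet_normal S' \<bullet> w)" if "w \<in> S" for w
  proof (rule mult_nonneg_nonneg)
    have "w \<in> \<Union>K" using that S by (rule UnionI[rotated])
    then show "0 \<le> 1 - facet_normal S' \<bullet> w" using complex_normal_le_1[OF S'] by simp
  qed (use r(1) that in simp)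
  ultimately have "\<forall>w\<in>S. ?r w * (1 - facet_normal S' \<bullet> w) = 0"
    by (simp add: sum_nonneg_eq_0_iff[OF lattice_basis_finite[OF complex_basis[OF S]]])
  then have "?r w = 0" if "w \<in> S" "w \<notin> S'" for w
    using complex_normal_le_0[OF S', of w] that S by fastforce
  then have "\<forall>w\<in>S - T \<inter> S'. ?r w = 0" using r(2) by blast
  moreover have "T \<inter> S' \<subseteq> S" using T by blast
  ultimately show ?thesis
    using r(1) lattice_basis_span[OF complex_basis[OF S]]
    by (simp add: mem_cone_iff_representation[OF iS])
qed

lemma complex_cone_Int:
  assumes S: "S \<in> K" and S': "S' \<in> K" and T: "T \<subseteq> S" and T': "T' \<subseteq> S'"
  shows "convex_cone hull T \<inter> convex_cone hull T' = convex_cone hull (T \<inter> T')"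
proof
  show "convex_cone hull T \<inter> convex_cone hull T' \<subseteq> convex_cone hull (T \<inter> T')"
  proof
    fix x assume x: "x \<in> convex_cone hull T \<inter> convex_cone hull T'"
    then have "x \<in> convex_cone hull S'" using hull_mono[OF T'] by blast
    then have "x \<in> convex_cone hull (T \<inter> S')" using x complex_cone_Int_facet[OF S S' T] by blast
    then have "x \<in> convex_cone hull (T \<inter> S') \<inter> convex_cone hull T'" using x by blast
    also have "\<dots> = convex_cone hull (T \<inter> S' \<inter> T')"
      by (rule cone_Int_independent[OF complex_independent[OF S'] _ T']) blast
    finally show "x \<in> convex_cone hull (T \<inter> T')" using T' by (simp add: Int_assoc Int_absorb1)
  qed
qed (simp add: hull_mono)

lemma complex_vertex_mem_cone:
  assumes S: "S \<in> K" and T: "T \<subseteq> S" and v: "v \<in> \<Union>K" "v \<in> convex_cone hull T"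
  shows "v \<in> T"
proof (rule ccontr)
  assume "v \<notin> T"
  obtain S' where S': "S' \<in> K" "v \<in> S'" using v by blast
  have "v \<in> convex_cone hull {v} \<inter> convex_cone hull T" using v(2) by (simp add: hull_inc)
  also have "\<dots> = convex_cone hull ({v} \<inter> T)" using S' S T by (intro complex_cone_Int) auto
  also have "\<dots> = {0}" using \<open>v \<notin> T\<close> by simp
  finally show False using complex_independent[OF S'(1)] S'(2) dependent_zero by blast
qed

lemma complex_cone_subset_iff:
  assumes "S \<in> K" "T \<subseteq> S" "S' \<in> K" "T' \<subseteq> S'"
  shows "convex_cone hull T \<subseteq> convex_cone hull T' \<longleftrightarrow> T \<subseteq> T'"
proof
  assume "convex_cone hull T \<subseteq> convex_cone hull T'"
  then have "T \<subseteq> convex_cone hull T'" by (rule order_trans[OF hull_subset])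
  then show "T \<subseteq> T'" using complex_vertex_mem_cone[OF assms(3,4)] assms(1,2) by blast
qed (rule hull_mono)

text \<open>The vertices can be recovered from the fan, which makes the centre of a blow-up and the values of the
  support function computable on the complex.\<close>

lemma ray_gens_fan_of: "ray_gens (fan_of K) = \<Union>K"
proof
  show "\<Union>K \<subseteq> ray_gens (fan_of K)"
    using lattice_basis_primitive complex_basis by (force simp: ray_gens_def intro: fan_ofI)
  show "ray_gens (fan_of K) \<subseteq> \<Union>K"
  proof
    fix v assume "v \<in> ray_gens (fan_of K)"
    then have v: "primitive v" "convex_cone hull {v} \<in> fan_of K" by (auto simp: ray_gens_def)
    obtain T S where TS: "T \<subseteq> S" "S \<in> K" "convex_cone hull {v} = convex_cone hull T"
      using v(2) by (rule fan_ofE)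
    have "T = {v}" using ray_generator_of_cone[OF complex_basis[OF TS(2)] TS(1) v(1) TS(3)] .
    then show "v \<in> \<Union>K" using TS by blast
  qed
qed

lemma is_fan_fan_of: "is_fan (fan_of K)"
  unfolding is_fan_def
proof (intro conjI ballI allI impI)
  have "fan_of K \<subseteq> (\<lambda>T. convex_cone hull T) ` Pow (\<Union>K)"
    by (force elim: fan_ofE)
  then show "finite (fan_of K)" using complex_vertices_finite by (meson finite_Pow_iff finite_imageI finite_subset)
  show "fan_of K \<noteq> {}" using complex_nonempty fan_ofI by blast
  fix \<sigma> assume \<sigma>: "\<sigma> \<in> fan_of K"
  then obtain T S where TS: "T \<subseteq> S" "S \<in> K" "\<sigma> = convex_cone hull T" by (rule fan_ofE)
  note b = complex_basis[OF TS(2)] and i = complex_independent[OF TS(2)]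
  show "rational_cone \<sigma>"
    unfolding rational_cone_def using TS lattice_basis_finite[OF b] lattice_basis_subset[OF b]
    by (intro exI[of _ T]) (auto intro: finite_subset)
  show "strongly_convex \<sigma>"
    unfolding strongly_convex_def
  proof (intro subset_antisym subsetI)
    fix x assume x: "x \<in> \<sigma> \<inter> uminus ` \<sigma>"
    moreover have "\<sigma> \<subseteq> convex_cone hull S" unfolding TS(3) by (rule hull_mono[OF TS(1)])
    ultimately have "x \<in> convex_cone hull S" "- x \<in> convex_cone hull S" by auto
    then have "\<forall>v\<in>S. 0 \<le> representation S x v" "\<forall>v\<in>S. 0 \<le> - representation S x v"
      using representation_neg[OF i, of x] lattice_basis_span[OF b]
      by (auto simp: mem_cone_lattice_basis_iff[OF b])
    then have "\<forall>v\<in>S. representation S x v = 0" by force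
    then have "(\<Sum>v\<in>S. representation S x v *\<^sub>R v) = 0" by simp
    then show "x \<in> {0}"
      using sum_representation_eq[OF i, of x S] lattice_basis_span[OF b] lattice_basis_finite[OF b] by simp
  next
    fix x :: "real^'n" assume "x \<in> {0}"
    then show "x \<in> \<sigma> \<inter> uminus ` \<sigma>"
      using TS(3) convex_cone_hull_contains_0[of T] by force
  qed
  {
    fix \<tau> assume \<tau>: "\<tau> face_of \<sigma> \<and> \<tau> \<noteq> {}"
    have "independent T" using i TS(1) independent_mono by blast
    then have "\<tau> = convex_cone hull (T \<inter> \<tau>)" using \<tau> TS(3) face_of_cone_eq by blast
    moreover have "convex_cone hull (T \<inter> \<tau>) \<in> fan_of K" using TS(1,2) by (intro fan_ofI[of _ S]) auto
    ultimately show "\<tau> \<in> fan_of K" by simp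
  }
  {
    fix \<sigma>' assume "\<sigma>' \<in> fan_of K"
    then obtain T' S' where TS': "T' \<subseteq> S'" "S' \<in> K" "\<sigma>' = convex_cone hull T'" by (rule fan_ofE)
    have eq: "\<sigma> \<inter> \<sigma>' = convex_cone hull (T \<inter> T')"
      using complex_cone_Int[OF TS(2) TS'(2) TS(1) TS'(1)] TS TS' by simp
    have "independent T" "independent T'"
      using i TS(1) TS'(1) complex_independent[OF TS'(2)] independent_mono by blast+
    then show "\<sigma> \<inter> \<sigma>' face_of \<sigma>" "\<sigma> \<inter> \<sigma>' face_of \<sigma>'"
      unfolding eq unfolding TS(3) TS'(3) by (simp_all add: cone_face_of_cone)
  }
qed

text \<open>The support function of the anticanonical divisor is the minimum of the negated facet
  normals. By maximality of normals on their own cones it is linear on each cone, and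
  by \<open>mem_cone_if_normal_maximal\<close> the cone is the whole region where its form attains the minimum.\<close>

lemma ample_anticanonical: "ample (fan_of K) (\<lambda>v. - canonical_divisor v)"
  unfolding ample_def
proof (intro exI conjI)
  define \<phi> where "\<phi> = (\<lambda>x. - Max ((\<lambda>S. facet_normal S \<bullet> x) ` K))"
  have \<phi>_le: "\<phi> x \<le> - (facet_normal S \<bullet> x)" if "S \<in> K" for S x
    using that complex_finite by (simp add: \<phi>_def)
  have \<phi>_eq: "\<phi> x = - (facet_normal S \<bullet> x)" if "S \<in> K" "x \<in> convex_cone hull S" for S x
    unfolding \<phi>_def neg_equal_iff_equal using that complex_finite complex_normal_max_on_cone[OF that]
    by (intro Max_eqI) auto
  show "support_function (fan_of K) (\<lambda>v. - canonical_divisor v) \<phi>"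
    unfolding support_function_def
  proof (intro conjI ballI)
    fix \<sigma> assume "\<sigma> \<in> fan_of K"
    then obtain T S where TS: "T \<subseteq> S" "S \<in> K" "\<sigma> = convex_cone hull T" by (rule fan_ofE)
    have "- facet_normal S \<in> std_lattice"
      using facet_normal_in_lattice[OF complex_basis[OF TS(2)]] by (auto simp: std_lattice_def)
    moreover have "\<forall>x\<in>\<sigma>. \<phi> x = - facet_normal S \<bullet> x"
      using \<phi>_eq[OF TS(2)] hull_mono[OF TS(1)] unfolding TS(3) by auto
    ultimately show "\<exists>m\<in>std_lattice. \<forall>x\<in>\<sigma>. \<phi> x = m \<bullet> x" by blast
  next
    fix v assume "v \<in> ray_gens (fan_of K)"
    then obtain S where "S \<in> K" "v \<in> S" by (auto simp: ray_gens_fan_of)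
    then show "\<phi> v = - of_int (- canonical_divisor v)"
      using \<phi>_eq[of S v] complex_normal_eq_1[of S v] by (simp add: canonical_divisor_def hull_inc)
  qed
  show "strictly_convex_support (fan_of K) \<phi>"
    unfolding strictly_convex_support_def
  proof (intro conjI ballI impI allI)
    show "concave_on UNIV \<phi>"
      unfolding concave_on_iff
    proof (intro conjI ballI allI impI)
      fix x y :: "real^'n" and u v :: real assume uv: "0 \<le> u" "0 \<le> v" "u + v = 1"
      obtain S where S: "S \<in> K" "u *\<^sub>R x + v *\<^sub>R y \<in> convex_cone hull S" by (rule complex_covers)
      have "u * \<phi> x + v * \<phi> y \<le> u * - (facet_normal S \<bullet> x) + v * - (facet_normal S \<bullet> y)"
        using uv \<phi>_le[OF S(1)] by (intro add_mono mult_left_mono) auto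
      also have "\<dots> = \<phi> (u *\<^sub>R x + v *\<^sub>R y)"
        using \<phi>_eq[OF S] by (simp add: inner_add_right)
      finally show "u * \<phi> x + v * \<phi> y \<le> \<phi> (u *\<^sub>R x + v *\<^sub>R y)" .
    qed simp
    fix \<sigma> m x assume \<sigma>: "\<sigma> \<in> fan_of K" "dim \<sigma> = CARD('n)"
      and m: "\<forall>x\<in>\<sigma>. \<phi> x = m \<bullet> x" and x: "\<phi> x = m \<bullet> x"
    obtain T S where TS: "T \<subseteq> S" "S \<in> K" "\<sigma> = convex_cone hull T" using \<sigma>(1) by (rule fan_ofE)
    note b = complex_basis[OF TS(2)]
    have "T = S" using sub_basis_eq_of_dim[OF b TS(1)] \<sigma>(2) TS(3) by simp
    have "- m = facet_normal S"
    proof (rule facet_normal_unique[OF b])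
      fix v assume v: "v \<in> S"
      then have "v \<in> \<sigma>" using TS(3) \<open>T = S\<close> by (simp add: hull_inc)
      then show "- m \<bullet> v = 1"
        using m \<phi>_eq[OF TS(2), of v] TS(3) \<open>T = S\<close> complex_normal_eq_1[OF TS(2) v] by simp
    qed
    then have "\<phi> x = - (facet_normal S \<bullet> x)" using x by (metis inner_minus_left minus_minus)
    then have "facet_normal S' \<bullet> x \<le> facet_normal S \<bullet> x" if "S' \<in> K" for S'
      using \<phi>_le[OF that, of x] by simp
    then show "x \<in> \<sigma>" using mem_cone_if_normal_maximal[OF TS(2)] TS(3) \<open>T = S\<close> by blast
  qed
qed

text \<open>Completeness is the covering lemma: the facet whose normal is maximal at a point contains it.\<close>

theorem nonsingular_toric_fano_fan_of: "nonsingular_toric_fano (fan_of K)"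
  unfolding nonsingular_toric_fano_def
proof (intro conjI is_fan_fan_of ample_anticanonical)
  show "complete_fan (fan_of K)"
    unfolding complete_fan_def
  proof (rule UNIV_eq_I[symmetric])
    fix x
    obtain S where "S \<in> K" "x \<in> convex_cone hull S" by (rule complex_covers)
    then show "x \<in> \<Union> (fan_of K)" using fan_ofI[OF order.refl] by blast
  qed
  show "nonsingular_fan (fan_of K)"
    unfolding nonsingular_fan_def
  proof
    fix \<sigma> assume "\<sigma> \<in> fan_of K"
    then obtain T S where "T \<subseteq> S" "S \<in> K" "\<sigma> = convex_cone hull T" by (rule fan_ofE)
    then show "\<exists>B S. lattice_basis B \<and> S \<subseteq> B \<and> \<sigma> = convex_cone hull S" 
      using complex_basis by blast
  qed
qed

end

text \<open>A set of facets that is closed under passing to neighbours is itself a Fano complex, so its cones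
  cover the space. A further facet would have an interior point in one of these cones.\<close>

lemma fano_subcomplex_eq:
  assumes K: "fano_complex K" and L: "L \<subseteq> K" "L \<noteq> {}"
    and closed: "\<And>S v. S \<in> L \<Longrightarrow> v \<in> S \<Longrightarrow> \<exists>S'\<in>L. S \<inter> S' = S - {v}"
  shows "L = K"
proof
  have "\<Union>L \<subseteq> \<Union>K" using L by blast
  then have L': "fano_complex L"
    unfolding fano_complex_def
    using K L closed finite_subset[OF L(1)] by (auto simp: fano_complex_def subset_iff)
  show "K \<subseteq> L"
  proof
    fix S assume S: "S \<in> K"
    define x where "x = (\<Sum>v\<in>S. 1 *\<^sub>R v)"
    obtain S' where S': "S' \<in> L" "x \<in> convex_cone hull S'" by (rule complex_covers[OF L'])
    then have S'K: "S' \<in> K" using L by blast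
    have i: "independent S" and fin: "finite S"
      using complex_basis[OF K S] lattice_basis_independent lattice_basis_finite by blast+
    have xS: "x \<in> convex_cone hull S" unfolding x_def by (rule sum_scaleR_in_convex_cone_hull) auto
    have "x \<in> convex_cone hull (S \<inter> S')"
      using complex_cone_Int[OF K S S'K order.refl order.refl] xS S'(2) by blast
    then have zero: "representation S x v = 0" if "v \<in> S" "v \<notin> S'" for v
      using that mem_cone_iff_representation[OF i, of "S \<inter> S'" x] by blast
    have one: "representation S x v = 1" if "v \<in> S" for v
    proof -
      have "representation S x v = (\<Sum>w\<in>S. representation S (1 *\<^sub>R w) v)"
        unfolding x_def using i by (simp add: representation_sum span_base)
      also have "\<dots> = (\<Sum>w\<in>S. if w = v then 1 else 0)"
        using i by (intro sum.cong) (auto simp: representation_basis)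
      also have "\<dots> = 1" using that fin by simp
      finally show ?thesis .
    qed
    have "S \<subseteq> S'" using zero one by force
    then have "S = S'"
      using lattice_basis_card[OF complex_basis[OF K S]] lattice_basis_card[OF complex_basis[OF K S'K]]
        lattice_basis_finite[OF complex_basis[OF K S'K]] by (metis card_subset_eq)
    then show "S \<in> L" using S' by simp
  qed
qed (rule L)

text \<open>The neighbouring facet has the same number of vertices, hence exactly one new vertex.\<close>

lemma complex_neighbour_vertex:
  fixes K :: "(real^'n) set set"
  assumes K: "fano_complex K" and S: "S \<in> K" and v: "v \<in> S"
  obtains w where "w \<notin> S" "insert w (S - {v}) \<in> K"
proof -
  obtain S' where S': "S' \<in> K" "S \<inter> S' = S - {v}" using complex_neighbour[OF K S v] .
  have fin: "finite S" "finite S'" using complex_basis[OF K] S S'(1) lattice_basis_finite by blast+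
  have card: "card S = CARD('n)" "card S' = CARD('n)"
    using complex_basis[OF K] S S'(1) lattice_basis_card by blast+
  have "card (S' - S) = card S' - card (S \<inter> S')" using fin by (simp add: card_Diff_subset_Int Int_commute)
  also have "\<dots> = 1" unfolding S'(2) using card fin v by (simp add: card_Diff_singleton)
  finally obtain w where w: "S' - S = {w}" by (auto simp: card_1_singleton_iff)
  then have "S' = insert w (S - {v})" using S'(2) by blast
  then show ?thesis using that[of w] w S'(1) by blast
qed

section \<open>The complex of a Fano fan\<close>

lemma dim_lattice_basis_cone:
  fixes S :: "(real^'n) set"
  assumes "lattice_basis S"
  shows "dim (convex_cone hull S) = CARD('n)"
proof -
  have "UNIV \<subseteq> span (convex_cone hull S)"
    using span_mono[OF hull_subset[of S convex_cone]] lattice_basis_span[OF assms] by simp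
  then have "dim (convex_cone hull S) = dim (UNIV :: (real^'n) set)"
    by (metis dim_span top.extremum_uniqueI)
  then show ?thesis by simp
qed

context
  fixes \<Sigma> :: "(real^'n) set set" and \<phi>
  assumes fan: "is_fan \<Sigma>" and complete: "complete_fan \<Sigma>" and nonsing: "nonsingular_fan \<Sigma>"
    and supp: "support_function \<Sigma> (\<lambda>v. - canonical_divisor v) \<phi>"
    and strict: "strictly_convex_support \<Sigma> \<phi>"
begin

definition facets :: "(real^'n) set set" where
  "facets = {S. lattice_basis S \<and> convex_cone hull S \<in> \<Sigma>}"

lemma fan_finite: "finite \<Sigma>"
  using fan unfolding is_fan_def by blast

lemma fan_face: "\<sigma> \<in> \<Sigma> \<Longrightarrow> \<tau> face_of \<sigma> \<Longrightarrow> \<tau> \<noteq> {} \<Longrightarrow> \<tau> \<in> \<Sigma>"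
  using fan unfolding is_fan_def by blast

lemma fan_cone:
  assumes "\<sigma> \<in> \<Sigma>"
  obtains B T where "lattice_basis B" "T \<subseteq> B" "\<sigma> = convex_cone hull T"
  using nonsing assms unfolding nonsingular_fan_def by blast

lemma facet_vertex_ray:
  assumes "S \<in> facets" "v \<in> S"
  shows "v \<in> ray_gens \<Sigma>"
proof -
  have S: "lattice_basis S" "convex_cone hull S \<in> \<Sigma>" using assms by (auto simp: facets_def)
  have "convex_cone hull {v} face_of convex_cone hull S"
    using assms S lattice_basis_independent by (intro cone_face_of_cone) auto
  then have "convex_cone hull {v} \<in> \<Sigma>" using fan_face[OF S(2)] convex_cone_hull_nonempty by blast
  then show ?thesis using lattice_basis_primitive[OF S(1) assms(2)] by (simp add: ray_gens_def)
qed

text \<open>Distinct primitive vectors span distinct rays, and these rays are cones of the finite fan.\<close>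

lemma ray_gens_finite: "finite (ray_gens \<Sigma>)"
proof (rule finite_imageD)
  show "finite ((\<lambda>v. convex_cone hull {v}) ` ray_gens \<Sigma>)"
    by (rule finite_subset[OF _ fan_finite]) (auto simp: ray_gens_def)
  show "inj_on (\<lambda>v. convex_cone hull {v}) (ray_gens \<Sigma>)"
  proof (rule inj_onI)
    fix v w assume v: "v \<in> ray_gens \<Sigma>" and w: "w \<in> ray_gens \<Sigma>"
      and eq: "convex_cone hull {v} = convex_cone hull {w}"
    obtain B T where BT: "lattice_basis B" "T \<subseteq> B" "convex_cone hull {v} = convex_cone hull T"
      by (rule fan_cone[of "convex_cone hull {v}"]) (use v in \<open>auto simp: ray_gens_def\<close>)
    have pv: "primitive v" "primitive w" using v w by (auto simp: ray_gens_def)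
    have "T = {v}" by (rule ray_generator_of_cone[OF BT(1,2) pv(1) BT(3)])
    moreover have "T = {w}"
      by (rule ray_generator_of_cone[OF BT(1,2) pv(2)]) (simp add: eq[symmetric] BT(3))
    ultimately show "v = w" by simp
  qed
qed

lemma facets_finite: "finite facets"
  by (rule finite_subset[of _ "Pow (ray_gens \<Sigma>)"]) (use facet_vertex_ray ray_gens_finite in auto)

text \<open>The cones of smaller dimension form a negligible set, so the finitely many closed
  full-dimensional cones already cover.\<close>

lemma facets_cover:
  obtains S where "S \<in> facets" "x \<in> convex_cone hull S"
proof -
  let ?F = "\<Union>S\<in>facets. convex_cone hull S"
  let ?L = "{\<sigma>\<in>\<Sigma>. dim \<sigma> < CARD('n)}"
  have cl: "closed (convex_cone hull S)" if "S \<in> facets" for S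
    using that lattice_basis_finite closed_convex_cone_hull by (auto simp: facets_def)
  have "- ?F \<subseteq> \<Union>?L"
  proof
    fix y assume y: "y \<in> - ?F"
    obtain \<sigma> where \<sigma>: "\<sigma> \<in> \<Sigma>" "y \<in> \<sigma>" using complete unfolding complete_fan_def by blast
    obtain B T where BT: "lattice_basis B" "T \<subseteq> B" "\<sigma> = convex_cone hull T" using \<sigma>(1) by (rule fan_cone)
    have "dim \<sigma> \<noteq> CARD('n)"
    proof
      assume "dim \<sigma> = CARD('n)"
      then have "T = B" using BT sub_basis_eq_of_dim by blast
      then show False using y \<sigma> BT by (auto simp: facets_def)
    qed
    moreover have "dim \<sigma> \<le> CARD('n)" using dim_subset_UNIV[of \<sigma>] by simp
    ultimately show "y \<in> \<Union>?L" using \<sigma> by auto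
  qed
  moreover have "negligible (\<Union>?L)"
    using fan_finite by (intro negligible_Union) (auto intro: negligible_lowdim)
  ultimately have "negligible (- ?F)" using negligible_subset by blast
  moreover have "open (- ?F)" using cl facets_finite by (intro open_Compl closed_UN) auto
  ultimately have "- ?F = {}" using open_not_negligible by blast
  then show ?thesis using that by blast
qed

lemma facets_basis: "S \<in> facets \<Longrightarrow> lattice_basis S"
  by (simp add: facets_def)

lemma support_vertex: "v \<in> ray_gens \<Sigma> \<Longrightarrow> \<phi> v = -1"
  using supp unfolding support_function_def by (simp add: canonical_divisor_def)

text \<open>The anticanonical support function takes the value \<open>-1\<close> at all ray generators, so on a maximal cone
  it is the negated normal of the generators.\<close>

lemma support_on_facet:
  assumes "S \<in> facets" "x \<in> convex_cone hull S"
  shows "\<phi> x = - facet_normal S \<bullet> x"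
proof -
  have "convex_cone hull S \<in> \<Sigma>" and b: "lattice_basis S" using assms by (auto simp: facets_def)
  then obtain m where m: "\<forall>x\<in>convex_cone hull S. \<phi> x = m \<bullet> x"
    using supp unfolding support_function_def by blast
  have "- m = facet_normal S"
  proof (rule facet_normal_unique[OF b])
    fix v assume "v \<in> S"
    then show "- m \<bullet> v = 1"
      using m support_vertex[OF facet_vertex_ray[OF assms(1)]] by (simp add: hull_inc)
  qed
  then show ?thesis using m assms(2) by (metis minus_minus)
qed

text \<open>Concavity extends the linear upper bound from the neighbourhood of an interior point of the
  cone to the whole space.\<close>

lemma support_le:
  assumes S: "S \<in> facets"
  shows "\<phi> x \<le> - facet_normal S \<bullet> x"
proof -
  note b = facets_basis[OF S]
  note i = lattice_basis_independent[OF b]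
  let ?m = "- facet_normal S" and ?r = "representation S x"
  define y where "y = (\<Sum>v\<in>S. 1 *\<^sub>R v)"
  have fin: "finite S" using b by (rule lattice_basis_finite)
  \<comment> \<open>Large enough that moving from \<open>y\<close> towards \<open>x\<close> by the fraction \<open>1 / (1 + M)\<close> stays in the cone.\<close>
  define M where "M = 1 + (\<Sum>v\<in>S. \<bar>?r v\<bar>)"
  have M: "1 \<le> M" by (simp add: M_def sum_nonneg)
  have rM: "\<bar>?r v\<bar> \<le> M" if "v \<in> S" for v
    unfolding M_def using member_le_sum[OF that, of "\<lambda>v. \<bar>?r v\<bar>"] fin by simp
  have yS: "y \<in> convex_cone hull S" unfolding y_def by (rule sum_scaleR_in_convex_cone_hull) auto
  define z where "z = (M / (1 + M)) *\<^sub>R y + (1 / (1 + M)) *\<^sub>R x"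
  have "z = (\<Sum>v\<in>S. ((M + ?r v) / (1 + M)) *\<^sub>R v)"
  proof -
    have "x = (\<Sum>v\<in>S. ?r v *\<^sub>R v)"
      using sum_representation_eq[OF i, of x S] lattice_basis_span[OF b] fin by simp
    then have "z = (M / (1 + M)) *\<^sub>R y + (1 / (1 + M)) *\<^sub>R (\<Sum>v\<in>S. ?r v *\<^sub>R v)"
      unfolding z_def by (rule arg_cong)
    then show ?thesis
      by (simp add: y_def scaleR_sum_right sum.distrib[symmetric] scaleR_add_left[symmetric] add_divide_distrib)
  qed
  then have zS: "z \<in> convex_cone hull S"
    using rM M by (auto intro!: sum_scaleR_in_convex_cone_hull divide_nonneg_nonneg) (smt (verit))
  have "concave_on UNIV \<phi>" using strict unfolding strictly_convex_support_def by blast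
  moreover have "0 \<le> M / (1 + M)" "0 \<le> 1 / (1 + M)" "M / (1 + M) + 1 / (1 + M) = 1"
    using M by (simp_all add: add_divide_distrib[symmetric] add.commute)
  ultimately have "(M / (1 + M)) * \<phi> y + (1 / (1 + M)) * \<phi> x \<le> \<phi> z"
    unfolding concave_on_iff z_def by blast
  then have "(M / (1 + M)) * (?m \<bullet> y) + (1 / (1 + M)) * \<phi> x \<le> ?m \<bullet> z"
    using support_on_facet[OF S] yS zS by simp
  also have "?m \<bullet> z = (M / (1 + M)) * (?m \<bullet> y) + (1 / (1 + M)) * (?m \<bullet> x)"
    by (simp only: z_def inner_add_right inner_scaleR_right)
  finally have "(1 / (1 + M)) * \<phi> x \<le> (1 / (1 + M)) * (?m \<bullet> x)" by linarith
  then show ?thesis using M by (subst (asm) mult_le_cancel_left_pos) auto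
qed

text \<open>Equality in the upper bound for the support function puts the vertex into the cone by strict
  convexity; as an integral point of height one of a unimodular cone it is one of the generators.
  Integrality of the normal turns the remaining strict inequality into the bound by zero.\<close>

lemma facets_normal_le_0:
  assumes S: "S \<in> facets" and v: "v \<in> \<Union>facets" "v \<notin> S"
  shows "facet_normal S \<bullet> v \<le> 0"
proof -
  note b = facets_basis[OF S]
  note i = lattice_basis_independent[OF b]
  obtain S' where S': "S' \<in> facets" "v \<in> S'" using v by blast
  have vr: "v \<in> ray_gens \<Sigma>" and vl: "primitive v" "v \<in> std_lattice"
    using facet_vertex_ray[OF S'] lattice_basis_subset[OF facets_basis[OF S'(1)]] S' by (auto simp: ray_gens_def)
  have le: "facet_normal S \<bullet> v \<le> 1" using support_le[OF S, of v] support_vertex[OF vr] by simp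
  have ne: "facet_normal S \<bullet> v \<noteq> 1"
  proof
    assume eq: "facet_normal S \<bullet> v = 1"
    have "convex_cone hull S \<in> \<Sigma>" using S by (simp add: facets_def)
    moreover have "\<forall>x\<in>convex_cone hull S. \<phi> x = - facet_normal S \<bullet> x"
      using support_on_facet[OF S] by blast
    moreover have "\<phi> v = - facet_normal S \<bullet> v" using support_vertex[OF vr] eq by simp
    ultimately have "v \<in> convex_cone hull S"
      using strict dim_lattice_basis_cone[OF b] unfolding strictly_convex_support_def by blast
    then have nn: "\<forall>w\<in>S. 0 \<le> representation S v w" by (simp add: mem_cone_lattice_basis_iff[OF b])
    have sum1: "(\<Sum>w\<in>S. representation S v w) = 1" using eq by (simp add: facet_normal_inner[OF b])
    then obtain w where w: "w \<in> S" "representation S v w > 0"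
      using nn by (metis less_le sum.neutral zero_neq_one)
    have "representation S v w \<ge> 1"
      using w(2) lattice_basis_representation_int[OF b vl(2), of w] by (auto elim!: Ints_cases)
    moreover have "(\<Sum>w\<in>S. representation S v w) = representation S v w + (\<Sum>u\<in>S-{w}. representation S v u)"
      using w(1) lattice_basis_finite[OF b] by (rule sum.remove[rotated])
    moreover have "0 \<le> (\<Sum>u\<in>S-{w}. representation S v u)" using nn by (intro sum_nonneg) auto
    ultimately have one: "representation S v w = 1" and zero: "(\<Sum>u\<in>S-{w}. representation S v u) = 0"
      using sum1 by linarith+
    have z: "\<forall>u\<in>S-{w}. representation S v u = 0"
      using zero nn lattice_basis_finite[OF b] by (subst (asm) sum_nonneg_eq_0_iff) auto
    have "v = (\<Sum>u\<in>S. representation S v u *\<^sub>R u)"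
      using sum_representation_eq[OF i, of v S] lattice_basis_span[OF b] lattice_basis_finite[OF b] by simp
    also have "\<dots> = representation S v w *\<^sub>R w + (\<Sum>u\<in>S-{w}. representation S v u *\<^sub>R u)"
      using w(1) lattice_basis_finite[OF b] by (rule sum.remove[rotated])
    also have "\<dots> = w" using z one by simp
    finally show False using v(2) w(1) by simp
  qed
  obtain k where "facet_normal S \<bullet> v = of_int k" using facet_normal_int[OF b vl(2)] by (auto elim!: Ints_cases)
  then show ?thesis using le ne by simp
qed

text \<open>The neighbour across a ridge is found by looking slightly beyond the ridge: integrality of
  the normals makes one point sufficient that is close enough for all facets at once.\<close>

lemma facets_neighbour:
  assumes S: "S \<in> facets" and v: "v \<in> S"
  obtains S' where "S' \<in> facets" "S \<inter> S' = S - {v}"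
proof -
  note b = facets_basis[OF S]
  have fin: "finite S" using b by (rule lattice_basis_finite)
  \<comment> \<open>With this scale the defect of \<open>S'\<close> along the ridge is a sum of nonnegative integers smaller than one.\<close>
  define N where "N = 1 + (\<Sum>S'\<in>facets. \<bar>1 - facet_normal S' \<bullet> v\<bar>)"
  have N: "1 \<le> N" by (simp add: N_def sum_nonneg)
  have NS: "\<bar>1 - facet_normal S' \<bullet> v\<bar> < N" if "S' \<in> facets" for S'
    unfolding N_def using member_le_sum[OF that, of "\<lambda>S'. \<bar>1 - facet_normal S' \<bullet> v\<bar>"] facets_finite by simp
  define x where "x = (\<Sum>w\<in>S-{v}. w) - (1/N) *\<^sub>R v"
  obtain S' where S': "S' \<in> facets" "x \<in> convex_cone hull S'" by (rule facets_cover)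
  note b' = facets_basis[OF S'(1)]
  have le1: "facet_normal S' \<bullet> w \<le> 1" if "w \<in> S" for w
    using facets_normal_le_0[OF S'(1), of w] facet_normal_eq_1[OF b', of w] that S
    by (cases "w \<in> S'") force+
  have "facet_normal S \<bullet> x \<le> facet_normal S' \<bullet> x"
    using support_le[OF S, of x] support_on_facet[OF S'] by simp
  moreover have "facet_normal S \<bullet> x = real (card (S - {v})) - 1/N"
    unfolding x_def inner_diff_right inner_sum_right inner_scaleR_right
    using facet_normal_eq_1[OF b] v by simp
  moreover have "facet_normal S' \<bullet> x = (\<Sum>w\<in>S-{v}. facet_normal S' \<bullet> w) - (facet_normal S' \<bullet> v) / N"
    unfolding x_def inner_diff_right inner_sum_right inner_scaleR_right by simp
  ultimately have "(\<Sum>w\<in>S-{v}. 1 - facet_normal S' \<bullet> w) \<le> (1 - facet_normal S' \<bullet> v) / N"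
    by (simp add: sum_subtractf diff_divide_distrib)
  also have "\<dots> < 1" using NS[OF S'(1)] N by (simp add: divide_less_eq)
  finally have small: "(\<Sum>w\<in>S-{v}. 1 - facet_normal S' \<bullet> w) < 1" .
  have "w \<in> S'" if w: "w \<in> S - {v}" for w
  proof (rule ccontr)
    assume "w \<notin> S'"
    then have "1 \<le> 1 - facet_normal S' \<bullet> w" using facets_normal_le_0[OF S'(1), of w] w S by auto
    also have "\<dots> \<le> (\<Sum>w\<in>S-{v}. 1 - facet_normal S' \<bullet> w)"
      using le1 w fin by (intro member_le_sum) auto
    finally show False using small by simp
  qed
  moreover have "v \<notin> S'"
  proof
    assume "v \<in> S'"
    then have "S \<subseteq> S'" using \<open>\<And>w. w \<in> S - {v} \<Longrightarrow> w \<in> S'\<close> by blast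
    then have "S = S'" using lattice_basis_card[OF b] lattice_basis_card[OF b'] lattice_basis_finite[OF b']
      by (metis card_subset_eq)
    then have "x \<in> convex_cone hull S" using S'(2) by simp
    then have "0 \<le> representation S x v" using v mem_cone_lattice_basis_iff[OF b] by blast
    have i: "independent S" using b by (rule lattice_basis_independent)
    have sp: "u \<in> span S" for u using lattice_basis_span[OF b] by simp
    have "representation S x v = (\<Sum>w\<in>S-{v}. representation S w v) - (1/N) * representation S v v"
      unfolding x_def using i sp by (simp add: representation_diff representation_sum representation_scale)
    also have "(\<Sum>w\<in>S-{v}. representation S w v) = 0"
      using i by (intro sum.neutral) (auto simp: representation_basis)
    also have "representation S v v = 1" using i v by (simp add: representation_basis)
    finally show False using \<open>0 \<le> representation S x v\<close> N by simp
  qed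
  ultimately have "S \<inter> S' = S - {v}" by blast
  then show ?thesis using that S'(1) by blast
qed

lemma fano_complex_facets: "fano_complex facets"
  unfolding fano_complex_def
  using facets_finite facets_cover facets_basis facets_normal_le_0 facets_neighbour
  by (metis DiffE empty_iff)

text \<open>Every cone lies in a full-dimensional one: follow the sum of its generators.\<close>

lemma fan_eq_fan_of_facets: "\<Sigma> = fan_of facets"
proof
  show "fan_of facets \<subseteq> \<Sigma>"
  proof
    fix \<sigma> assume "\<sigma> \<in> fan_of facets"
    then obtain T S where TS: "T \<subseteq> S" "S \<in> facets" "\<sigma> = convex_cone hull T" by (rule fan_ofE)
    have "convex_cone hull T face_of convex_cone hull S"
      using TS lattice_basis_independent facets_basis by (intro cone_face_of_cone) auto
    then show "\<sigma> \<in> \<Sigma>" unfolding TS(3)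
      using fan_face[of "convex_cone hull S"] TS(2) convex_cone_hull_nonempty by (auto simp: facets_def)
  qed
  show "\<Sigma> \<subseteq> fan_of facets"
  proof
    fix \<sigma> assume \<sigma>: "\<sigma> \<in> \<Sigma>"
    obtain B T where BT: "lattice_basis B" "T \<subseteq> B" "\<sigma> = convex_cone hull T" using \<sigma> by (rule fan_cone)
    have finT: "finite T" using BT lattice_basis_finite finite_subset by blast
    define y where "y = (\<Sum>v\<in>T. 1 *\<^sub>R v)"
    obtain S where S: "S \<in> facets" "y \<in> convex_cone hull S" by (rule facets_cover)
    have S\<Sigma>: "convex_cone hull S \<in> \<Sigma>" using S by (simp add: facets_def)
    let ?\<tau> = "\<sigma> \<inter> convex_cone hull S"
    have f: "?\<tau> face_of \<sigma>" "?\<tau> face_of convex_cone hull S"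
      using fan \<sigma> S\<Sigma> unfolding is_fan_def by blast+
    have y\<sigma>: "y \<in> \<sigma>" unfolding y_def BT(3) by (rule sum_scaleR_in_convex_cone_hull) auto
    have y: "y \<in> ?\<tau>" using y\<sigma> S by blast
    have "t \<in> ?\<tau>" if t: "t \<in> T" for t
    proof (rule face_of_cone_summand[OF f(1)[unfolded BT(3)], folded BT(3)])
      show "t \<in> \<sigma>" using t BT(3) by (simp add: hull_inc)
      show "(\<Sum>v\<in>T-{t}. 1 *\<^sub>R v) \<in> \<sigma>" unfolding BT(3) by (rule sum_scaleR_in_convex_cone_hull) auto
      show "t + (\<Sum>v\<in>T-{t}. 1 *\<^sub>R v) \<in> ?\<tau>" using y t finT by (simp add: y_def sum.remove)
    qed
    moreover have "convex_cone ?\<tau>" using convex_cone_face[OF f(2)] y by blast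
    ultimately have "\<sigma> \<subseteq> ?\<tau>" unfolding BT(3) by (intro hull_minimal) (auto simp: BT(3))
    then have "\<sigma> face_of convex_cone hull S" using f(2) by (simp add: Int_absorb2)
    then have "\<sigma> = convex_cone hull (S \<inter> \<sigma>)"
      using face_of_cone_eq[OF lattice_basis_independent[OF facets_basis[OF S(1)]]] y\<sigma> by blast
    then show "\<sigma> \<in> fan_of facets" using fan_ofI[of "S \<inter> \<sigma>" S facets] S(1) by simp
  qed
qed

end

text \<open>Together with \<open>nonsingular_toric_fano_fan_of\<close> this identifies the fans of nonsingular toric Fano
  varieties with Fano complexes.\<close>

theorem nonsingular_toric_fano_complex:
  assumes "nonsingular_toric_fano \<Sigma>"
  obtains K where "fano_complex K" "\<Sigma> = fan_of K"
proof -
  obtain \<phi> where "is_fan \<Sigma>" "complete_fan \<Sigma>" "nonsingular_fan \<Sigma>"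
    "support_function \<Sigma> (\<lambda>v. - canonical_divisor v) \<phi>" "strictly_convex_support \<Sigma> \<phi>"
    using assms unfolding nonsingular_toric_fano_def ample_def by blast
  then show ?thesis using that fano_complex_facets fan_eq_fan_of_facets by blast
qed

section \<open>Blow-ups of complexes\<close>

text \<open>Stellar subdivision at the sum of the vertices of the face \<open>T\<close>, on the level of facets.\<close>

definition blow_up :: "(real^'n) set set \<Rightarrow> (real^'n) set \<Rightarrow> (real^'n) set set" where
  "blow_up K T = {S\<in>K. \<not> T \<subseteq> S} \<union> {insert (\<Sum>T) (S - {t}) | S t. S \<in> K \<and> T \<subseteq> S \<and> t \<in> T}"

lemma blow_up_newI: "S \<in> K \<Longrightarrow> T \<subseteq> S \<Longrightarrow> t \<in> T \<Longrightarrow> insert (\<Sum>T) (S - {t}) \<in> blow_up K T"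
  unfolding blow_up_def by blast

text \<open>A subset of a facet avoids containing \<open>T\<close> iff it misses some \<open>t \<in> T\<close>; this matches the cones of the
  star subdivision with the subsets of the facets \<open>insert (\<Sum>T) (S - {t})\<close>.\<close>

lemma star_subdivision_fan_of:
  assumes K: "fano_complex K" and S0: "S0 \<in> K" and T: "T \<subseteq> S0"
  shows "star_subdivision (fan_of K) (convex_cone hull T) = fan_of (blow_up K T)"
proof -
  let ?C = "\<lambda>T. convex_cone hull T"
  have "ray_gens (fan_of K) \<inter> ?C T = T"
    using ray_gens_fan_of[OF K] complex_vertex_mem_cone[OF K S0 T] S0 T hull_subset[of T convex_cone]
    by blast
  then have s: "(\<Sum>v\<in>ray_gens (fan_of K) \<inter> ?C T. v) = \<Sum>T" by simp
  have ins: "?C (insert a (?C U)) = ?C (insert a U)" for a and U :: "(real^'a) set"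
    by (metis hull_insert)
  show ?thesis
  proof (intro subset_antisym subsetI)
    fix \<sigma> assume "\<sigma> \<in> star_subdivision (fan_of K) (?C T)"
    then consider "\<sigma> \<in> fan_of K" "\<not> ?C T \<subseteq> \<sigma>"
      | \<sigma>' \<rho> where "\<sigma> = ?C (insert (\<Sum>T) \<sigma>')" "\<rho> \<in> fan_of K" "?C T \<subseteq> \<rho>" "\<sigma>' face_of \<rho>" "\<sigma>' \<in> fan_of K" "\<not> ?C T \<subseteq> \<sigma>'"
      unfolding star_subdivision_def s by blast
    then show "\<sigma> \<in> fan_of (blow_up K T)"
    proof cases
      case 1
      obtain U S where U: "U \<subseteq> S" "S \<in> K" "\<sigma> = ?C U" using 1(1) by (rule fan_ofE)
      have "\<not> T \<subseteq> U" using 1(2) U(3) hull_mono[of T U convex_cone] by blast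
      show ?thesis
      proof (cases "T \<subseteq> S")
        case False
        then show ?thesis using U by (auto simp: blow_up_def intro: fan_ofI)
      next
        case True
        obtain t where t: "t \<in> T" "t \<notin> U" using \<open>\<not> T \<subseteq> U\<close> by blast
        have "insert (\<Sum>T) (S - {t}) \<in> blow_up K T" using True U(2) t(1) by (intro blow_up_newI)
        then show ?thesis unfolding U(3) using U(1) t by (intro fan_ofI) auto
      qed
    next
      case 2
      obtain A S where A: "A \<subseteq> S" "S \<in> K" "\<rho> = ?C A" using 2(2) by (rule fan_ofE)
      have TA: "T \<subseteq> A" using 2(3) complex_cone_subset_iff[OF K S0 T A(2,1)] A(3) by blast
      have iA: "independent A" using A complex_independent[OF K] independent_mono by blast
      have ne: "\<sigma>' \<noteq> {}" using 2(5) convex_cone_hull_nonempty by (auto elim!: fan_ofE)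
      define A' where "A' = A \<inter> \<sigma>'"
      have A': "\<sigma>' = ?C A'" unfolding A'_def using face_of_cone_eq[OF iA _ ne] 2(4) A(3) by blast
      have "\<not> T \<subseteq> A'" using 2(6) A' hull_mono[of T A' convex_cone] by blast
      then obtain t where t: "t \<in> T" "t \<notin> A'" by blast
      have "insert (\<Sum>T) (S - {t}) \<in> blow_up K T" using order_trans[OF TA A(1)] A(2) t(1) by (intro blow_up_newI)
      moreover have "A' \<subseteq> S" using A(1) unfolding A'_def by (rule le_infI1)
      then have "insert (\<Sum>T) A' \<subseteq> insert (\<Sum>T) (S - {t})" using t(2) by auto
      ultimately have "?C (insert (\<Sum>T) A') \<in> fan_of (blow_up K T)" by (intro fan_ofI)
      then show ?thesis unfolding 2(1) A' ins .
    qed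
  next
    fix \<sigma> assume "\<sigma> \<in> fan_of (blow_up K T)"
    then obtain U S' where U: "U \<subseteq> S'" "S' \<in> blow_up K T" "\<sigma> = ?C U" by (rule fan_ofE)
    have old: "\<sigma> \<in> star_subdivision (fan_of K) (?C T)" if "U \<subseteq> S" "S \<in> K" "\<not> T \<subseteq> U" for S
      using that U(3) complex_cone_subset_iff[OF K S0 T that(2,1)] unfolding star_subdivision_def
      by (auto intro: fan_ofI)
    from U(2) consider "S' \<in> K" "\<not> T \<subseteq> S'"
      | S t where "S' = insert (\<Sum>T) (S - {t})" "S \<in> K" "T \<subseteq> S" "t \<in> T"
      unfolding blow_up_def by blast
    then show "\<sigma> \<in> star_subdivision (fan_of K) (?C T)"
    proof cases
      case 1
      then show ?thesis using old[of S'] U(1) by blast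
    next
      case 2
      show ?thesis
      proof (cases "\<Sum>T \<in> U")
        case False
        then have "U \<subseteq> S" "\<not> T \<subseteq> U" using U(1) 2 by blast+
        then show ?thesis using old 2(2) by blast
      next
        case True
        let ?A = "U - {\<Sum>T}"
        have A: "?A \<subseteq> S" "\<not> T \<subseteq> ?A" "insert (\<Sum>T) ?A = U" using True U(1) 2 by blast+
        have "\<sigma> = ?C (insert (\<Sum>T) (?C ?A))" unfolding ins A(3) by (rule U(3))
        moreover have "?C S \<in> fan_of K" "?C ?A \<in> fan_of K" using 2(2) A(1) by (auto intro: fan_ofI)
        moreover have "?C T \<subseteq> ?C S" using 2(3) by (rule hull_mono)
        moreover have "?C ?A face_of ?C S" using complex_independent[OF K 2(2)] A(1) by (rule cone_face_of_cone)
        moreover have "\<not> ?C T \<subseteq> ?C ?A" using complex_cone_subset_iff[OF K S0 T 2(2) A(1)] A(2) by blast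
        ultimately show ?thesis unfolding star_subdivision_def s by blast
      qed
    qed
  qed
qed

lemma fan_iso_refl: "fan_iso \<Sigma> \<Sigma>"
  unfolding fan_iso_def by (intro exI[of _ "\<lambda>x. x"]) (auto simp: linear_iff bij_def)

lemma equivariant_blowup_fan_of:
  assumes K: "fano_complex K" and S0: "S0 \<in> K" and T: "T \<subseteq> S0" "T \<noteq> {}"
  shows "equivariant_blowup (fan_of (blow_up K T)) (fan_of K)"
  unfolding equivariant_blowup_def
proof (intro bexI conjI)
  obtain t where t: "t \<in> T" using T by blast
  then have "t \<noteq> 0" using complex_independent[OF K S0] T dependent_zero by blast
  then show "convex_cone hull T \<noteq> {0}" using hull_inc[OF t, of convex_cone] by blast
  show "fan_iso (fan_of (blow_up K T)) (star_subdivision (fan_of K) (convex_cone hull T))"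
    unfolding star_subdivision_fan_of[OF K S0 T(1)] by (rule fan_iso_refl)
  show "convex_cone hull T \<in> fan_of K" using T(1) S0 by (rule fan_ofI)
qed

section \<open>Lattice automorphisms\<close>

lemma linear_inv_of_bij:
  fixes f :: "'a::euclidean_space \<Rightarrow> 'b::euclidean_space"
  assumes f: "linear f" "bij f"
  shows "linear (inv f)"
proof (rule linearI)
  fix x y and c :: real
  have s: "f (inv f z) = z" for z using f(2) by (simp add: bij_is_surj surj_f_inv_f)
  have "f (inv f x + inv f y) = x + y" "f (c *\<^sub>R inv f x) = c *\<^sub>R x"
    using f(1) by (simp_all add: linear_add linear_scale s)
  then show "inv f (x + y) = inv f x + inv f y" "inv f (c *\<^sub>R x) = c *\<^sub>R inv f x"
    using f(2) by (metis bij_inv_eq_iff)+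
qed

lemma fan_iso_sym:
  assumes "fan_iso \<Sigma> \<Sigma>'"
  shows "fan_iso \<Sigma>' \<Sigma>"
proof -
  obtain f where f: "linear f" "bij f" "f ` std_lattice = std_lattice" "(\<lambda>\<sigma>. f ` \<sigma>) ` \<Sigma> = \<Sigma>'"
    using assms unfolding fan_iso_def by blast
  have inv: "inv f ` (f ` A) = A" for A using f(2) by (simp add: bij_is_inj image_image)
  have "inv f ` std_lattice = std_lattice" using inv[of std_lattice] f(3) by simp
  moreover have "(\<lambda>\<sigma>. inv f ` \<sigma>) ` \<Sigma>' = \<Sigma>" unfolding f(4)[symmetric]
    using inv by (auto simp: image_iff)
  ultimately show ?thesis
    unfolding fan_iso_def using linear_inv_of_bij[OF f(1,2)] bij_imp_bij_inv[OF f(2)] by blast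
qed

lemma fan_iso_trans:
  assumes "fan_iso \<Sigma> \<Sigma>'" "fan_iso \<Sigma>' \<Sigma>''"
  shows "fan_iso \<Sigma> \<Sigma>''"
proof -
  obtain f where f: "linear f" "bij f" "f ` std_lattice = std_lattice" "(\<lambda>\<sigma>. f ` \<sigma>) ` \<Sigma> = \<Sigma>'"
    using assms(1) unfolding fan_iso_def by blast
  obtain g where g: "linear g" "bij g" "g ` std_lattice = std_lattice" "(\<lambda>\<sigma>. g ` \<sigma>) ` \<Sigma>' = \<Sigma>''"
    using assms(2) unfolding fan_iso_def by blast
  have "linear (g \<circ> f)" using f(1) g(1) by (rule linear_compose)
  moreover have "bij (g \<circ> f)" using f(2) g(2) by (rule bij_comp)
  moreover have "(g \<circ> f) ` std_lattice = std_lattice" by (simp only: image_comp[symmetric] f(3) g(3))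
  moreover have "(\<lambda>\<sigma>. (g \<circ> f) ` \<sigma>) ` \<Sigma> = \<Sigma>''"
    unfolding g(4)[symmetric] f(4)[symmetric] by (simp only: image_image image_comp[symmetric])
  ultimately show ?thesis unfolding fan_iso_def by blast
qed

lemma fan_of_image:
  assumes "linear f"
  shows "fan_of ((\<lambda>S. f ` S) ` K) = (\<lambda>\<sigma>. f ` \<sigma>) ` fan_of K"
proof (intro subset_antisym subsetI)
  fix \<sigma> assume "\<sigma> \<in> fan_of ((\<lambda>S. f ` S) ` K)"
  then obtain T S where "T \<subseteq> f ` S" "S \<in> K" "\<sigma> = convex_cone hull T" by (auto elim!: fan_ofE)
  moreover from this obtain U where "U \<subseteq> S" "T = f ` U" by (auto simp: subset_image_iff)
  ultimately show "\<sigma> \<in> (\<lambda>\<sigma>. f ` \<sigma>) ` fan_of K"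
    using convex_cone_hull_linear_image[OF assms] by (auto intro: fan_ofI)
next
  fix \<sigma> assume "\<sigma> \<in> (\<lambda>\<sigma>. f ` \<sigma>) ` fan_of K"
  then obtain T S where TS: "T \<subseteq> S" "S \<in> K" "\<sigma> = f ` (convex_cone hull T)" by (auto elim!: fan_ofE)
  have "convex_cone hull (f ` T) \<in> fan_of ((\<lambda>S. f ` S) ` K)"
    using TS(1,2) by (intro fan_ofI[of _ "f ` S"]) auto
  then show "\<sigma> \<in> fan_of ((\<lambda>S. f ` S) ` K)"
    unfolding TS(3) convex_cone_hull_linear_image[OF assms] .
qed

lemma lattice_basis_image:
  assumes f: "linear f" "inj f" "f ` std_lattice = std_lattice" and S: "lattice_basis S"
  shows "lattice_basis (f ` S)"
  unfolding lattice_basis_def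
proof
  show "independent (f ` S)"
    by (rule linear_independent_injective_image[OF f(1) lattice_basis_independent[OF S] inj_on_subset[OF f(2)]]) simp
  have sum: "(\<Sum>b\<in>f ` S. of_int (c b) *\<^sub>R b) = f (\<Sum>b\<in>S. of_int (c (f b)) *\<^sub>R b)" for c :: "_ \<Rightarrow> int"
    using f by (simp add: sum.reindex inj_on_subset linear_sum linear_scale)
  have "{\<Sum>b\<in>f ` S. of_int (c b) *\<^sub>R b | c :: _ \<Rightarrow> int. True}
      = f ` {\<Sum>b\<in>S. of_int (c b) *\<^sub>R b | c :: _ \<Rightarrow> int. True}"
  proof (intro subset_antisym subsetI)
    fix x assume "x \<in> f ` {\<Sum>b\<in>S. of_int (c b) *\<^sub>R b | c :: _ \<Rightarrow> int. True}"
    then obtain c :: "_ \<Rightarrow> int" where "x = f (\<Sum>b\<in>S. of_int (c b) *\<^sub>R b)" by blast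
    then have "x = (\<Sum>b\<in>f ` S. of_int ((c \<circ> inv f) b) *\<^sub>R b)"
      unfolding sum using f(2) by simp
    then show "x \<in> {\<Sum>b\<in>f ` S. of_int (c b) *\<^sub>R b | c :: _ \<Rightarrow> int. True}" by blast
  qed (auto simp: sum)
  also have "\<dots> = std_lattice" using S f(3) by (simp add: lattice_basis_def)
  finally show "{\<Sum>b\<in>f ` S. of_int (c b) *\<^sub>R b | c :: _ \<Rightarrow> int. True} = std_lattice" .
qed

lemma facet_normal_image:
  assumes f: "linear f" "bij f" "f ` std_lattice = std_lattice" and S: "lattice_basis S"
  shows "facet_normal (f ` S) \<bullet> f x = facet_normal S \<bullet> x"
proof -
  define m where "m = adjoint (inv f) (facet_normal S)"
  have m: "m \<bullet> f y = facet_normal S \<bullet> y" for y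
    using adjoint_works[OF linear_inv_of_bij[OF f(1,2)], of "f y" "facet_normal S"] f(2)
    by (simp add: m_def inner_commute bij_is_inj)
  have "m = facet_normal (f ` S)"
    using lattice_basis_image[OF f(1) bij_is_inj[OF f(2)] f(3) S] m facet_normal_eq_1[OF S]
    by (intro facet_normal_unique) auto
  then show ?thesis using m by simp
qed

lemma fano_complex_image:
  assumes f: "linear f" "bij f" "f ` std_lattice = std_lattice" and K: "fano_complex K"
  shows "fano_complex ((\<lambda>S. f ` S) ` K)"
  unfolding fano_complex_def
proof (intro conjI ballI)
  show "finite ((\<lambda>S. f ` S) ` K)" "(\<lambda>S. f ` S) ` K \<noteq> {}"
    using complex_finite[OF K] complex_nonempty[OF K] by auto
  fix S' assume "S' \<in> (\<lambda>S. f ` S) ` K"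
  then obtain S where S: "S \<in> K" "S' = f ` S" by blast
  note b = complex_basis[OF K S(1)]
  have inj: "inj f" using f(2) by (rule bij_is_inj)
  show "lattice_basis S'" unfolding S(2) by (rule lattice_basis_image[OF f(1) inj f(3) b])
  {
    fix v assume "v \<in> \<Union> ((\<lambda>S. f ` S) ` K) - S'"
    then obtain u where "v = f u" "u \<in> \<Union>K" "u \<notin> S" using S(2) by blast
    then show "facet_normal S' \<bullet> v \<le> 0"
      unfolding S(2) using complex_normal_le_0[OF K S(1)] by (simp add: facet_normal_image[OF f b])
  }
  fix v assume "v \<in> S'"
  then obtain u where u: "v = f u" "u \<in> S" using S(2) by blast
  obtain R where "R \<in> K" "S \<inter> R = S - {u}" using complex_neighbour[OF K S(1) u(2)] .
  then have "f ` S \<inter> f ` R = f ` S - {f u}"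
    using inj by (metis image_Int image_insert image_set_diff image_empty)
  then show "\<exists>R\<in>(\<lambda>S. f ` S) ` K. S' \<inter> R = S' - {v}" using S u \<open>R \<in> K\<close> by blast
qed

lemma lattice_basis_map:
  fixes S S' :: "(real^'n) set"
  assumes S: "lattice_basis S" and S': "lattice_basis S'" and h: "bij_betw h S S'"
  obtains f :: "real^'n \<Rightarrow> real^'n" where "linear f" "bij f" "f ` std_lattice = std_lattice"
    "\<And>v. v \<in> S \<Longrightarrow> f v = h v"
proof -
  obtain f where f: "linear f" "\<forall>v\<in>S. f v = h v"
    using linear_independent_extend[OF lattice_basis_independent[OF S]] by blast
  have fS: "f ` S = S'" using f(2) h by (simp add: bij_betw_def)
  have "range f = UNIV"
    using linear_span_image[OF f(1), of S] lattice_basis_span[OF S] lattice_basis_span[OF S'] fS by simp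
  then have surj: "surj f" .
  then have bij: "bij f" using linear_surjective_imp_injective[OF f(1)] by (simp add: bij_def)
  have sum: "f (\<Sum>b\<in>S. of_int (c (h b)) *\<^sub>R b) = (\<Sum>b\<in>S'. of_int (c b) *\<^sub>R b)" for c :: "_ \<Rightarrow> int"
    using f h by (simp add: linear_sum linear_scale bij_betw_def sum.reindex flip: fS)
  have "f ` std_lattice = std_lattice"
  proof (intro subset_antisym subsetI)
    fix y assume "y \<in> f ` std_lattice"
    then obtain x where x: "x \<in> std_lattice" "y = f x" by blast
    obtain c :: "_ \<Rightarrow> int" where c: "x = (\<Sum>b\<in>S. of_int (c b) *\<^sub>R b)"
      by (rule lattice_basis_coefficients[OF S x(1)])
    have "y = (\<Sum>b\<in>S. of_int (c b) *\<^sub>R h b)" unfolding x(2) c using f by (simp add: linear_sum linear_scale)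
    moreover have "h b \<in> std_lattice" if "b \<in> S" for b
      using that h lattice_basis_subset[OF S'] by (auto simp: bij_betw_def)
    ultimately show "y \<in> std_lattice"
      using std_lattice_sum[of S h "\<lambda>b. of_int (c b)"] by simp
  next
    fix y :: "real^'n" assume y: "y \<in> std_lattice"
    obtain c :: "_ \<Rightarrow> int" where c: "y = (\<Sum>b\<in>S'. of_int (c b) *\<^sub>R b)"
      by (rule lattice_basis_coefficients[OF S' y])
    have "(\<Sum>b\<in>S. of_int (c (h b)) *\<^sub>R b) \<in> std_lattice"
      using lattice_basis_subset[OF S] by (intro std_lattice_sum) auto
    then have "f (\<Sum>b\<in>S. of_int (c (h b)) *\<^sub>R b) \<in> f ` std_lattice" by (rule imageI)
    then show "y \<in> f ` std_lattice" unfolding sum c .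
  qed
  then show ?thesis using that f bij by blast
qed

section \<open>F-equivalence of complexes\<close>

lemma fano_blowups_source: "fano_blowups Y X \<Longrightarrow> nonsingular_toric_fano Y"
  by (induction rule: fano_blowups.induct)

lemma fano_blowups_iso_target:
  assumes "fano_blowups Y X" "nonsingular_toric_fano X'" "fan_iso X X'"
  shows "fano_blowups Y X'"
  using assms by (induction rule: fano_blowups.induct) (auto intro: fano_blowups.intros fan_iso_trans)

lemma F_equivalent_refl: "nonsingular_toric_fano X \<Longrightarrow> F_equivalent X X"
  unfolding F_equivalent_def
  by (intro exI[of _ 0] exI[of _ "\<lambda>_. X"]) (auto simp: fan_iso_refl)

text \<open>Prepending a roof \<open>X1 \<leftarrow> W \<rightarrow> X2\<close>. The chain for \<open>X2\<close> starts with a variety that is only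
  isomorphic to \<open>X2\<close>, so the second leg of the roof is first composed with this isomorphism.\<close>

lemma F_equivalent_step:
  assumes X1: "nonsingular_toric_fano X1" and W1: "fano_blowups W X1" and W2: "fano_blowups W X2"
    and F: "F_equivalent X2 X3"
  shows "F_equivalent X1 X3"
proof -
  obtain l :: nat and Y where Y: "fan_iso (Y 0) X2" "fan_iso (Y (2 * l)) X3"
    "\<forall>i\<le>2 * l. nonsingular_toric_fano (Y i)"
    "\<forall>j. odd j \<and> j < 2 * l \<longrightarrow> fano_blowups (Y j) (Y (j - 1)) \<and> fano_blowups (Y j) (Y (j + 1))"
    using F unfolding F_equivalent_def by blast
  have W0: "fano_blowups W (Y 0)" using fano_blowups_iso_target[OF W2] Y(1,3) fan_iso_sym by blast
  define Z where "Z = (\<lambda>i. case i of 0 \<Rightarrow> X1 | Suc 0 \<Rightarrow> W | Suc (Suc k) \<Rightarrow> Y k)"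
  have Z: "Z 0 = X1" "Z (Suc 0) = W" "\<And>k. Z (Suc (Suc k)) = Y k" by (simp_all add: Z_def)
  have nons: "nonsingular_toric_fano (Z i)" if "i \<le> 2 * Suc l" for i
    using that X1 fano_blowups_source[OF W1] Y(3) by (cases i; cases "i - 1") (auto simp: Z)
  have links: "fano_blowups (Z j) (Z (j - 1)) \<and> fano_blowups (Z j) (Z (j + 1))"
    if j: "odd j" "j < 2 * Suc l" for j
  proof (cases "j = 1")
    case True
    then show ?thesis using W1 W0 Z(3)[of 0] by (simp add: Z)
  next
    case False
    have "j \<noteq> 0" using j(1) by (rule odd_pos[THEN gr_implies_not0])
    then obtain k where jk: "j = Suc (Suc k)" using False by (cases j; cases "j - 1") auto
    then have k: "j = Suc (Suc k)" "odd k" "k < 2 * l" using j by simp_all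
    have "Z (j - 1) = Y (k - 1)" using k Z(3)[of "k - 1"] by (cases k) auto
    then show ?thesis using k Y(4) by (simp add: Z)
  qed
  have "fan_iso (Z (2 * Suc l)) X3" using Y(2) Z(3)[of "2 * l"] by simp
  then show ?thesis
    unfolding F_equivalent_def using nons links Z(1) fan_iso_refl
    by (intro exI[of _ "Suc l"] exI[of _ Z]) auto
qed

lemma F_equivalent_iso:
  assumes "nonsingular_toric_fano X" "nonsingular_toric_fano X'" "fan_iso X X'" "F_equivalent X' X3"
  shows "F_equivalent X X3"
  using assms by (intro F_equivalent_step[of X X X']) (auto intro: fano_blowups.intros fan_iso_refl)

lemma fano_blowups_fan_of:
  assumes K: "fano_complex K" and K': "fano_complex (blow_up K T)" and T: "S \<in> K" "T \<subseteq> S" "T \<noteq> {}"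
  shows "fano_blowups (fan_of (blow_up K T)) (fan_of K)"
  by (rule fano_blowups.step[OF fano_blowups.empty])
    (use K K' T nonsingular_toric_fano_fan_of fan_iso_refl equivariant_blowup_fan_of in blast)+

lemma F_equivalent_image:
  assumes f: "linear f" "bij f" "f ` std_lattice = std_lattice" and K: "fano_complex K"
    and F: "F_equivalent (fan_of ((\<lambda>S. f ` S) ` K)) X"
  shows "F_equivalent (fan_of K) X"
proof (rule F_equivalent_iso[OF _ _ _ F])
  show "fan_iso (fan_of K) (fan_of ((\<lambda>S. f ` S) ` K))"
    unfolding fan_iso_def fan_of_image[OF f(1)] using f by blast
qed (use nonsingular_toric_fano_fan_of fano_complex_image[OF f] K in blast)+

text \<open>A single Fano blow-up is a roof one leg of which is the identity. It can be used in both directions.\<close>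

lemma F_equivalent_via_blow_up:
  assumes K: "fano_complex K" and K': "fano_complex (blow_up K T)" and T: "S \<in> K" "T \<subseteq> S" "T \<noteq> {}"
    and F: "F_equivalent (fan_of (blow_up K T)) X"
  shows "F_equivalent (fan_of K) X"
  using F_equivalent_step[OF _ fano_blowups_fan_of[OF K K' T] _ F] fano_blowups.empty
    nonsingular_toric_fano_fan_of K K' fan_iso_refl by blast

lemma F_equivalent_via_blow_down:
  assumes K: "fano_complex K" and K': "fano_complex (blow_up K T)" and T: "S \<in> K" "T \<subseteq> S" "T \<noteq> {}"
    and F: "F_equivalent (fan_of K) X"
  shows "F_equivalent (fan_of (blow_up K T)) X"
  using F_equivalent_step[OF _ _ fano_blowups_fan_of[OF K K' T] F] fano_blowups.empty
    nonsingular_toric_fano_fan_of K K' fan_iso_refl by blast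

section \<open>Triangulations of integral points as data\<close>

text \<open>Integral vectors are triples and facets are lists, so that the finite part of the argument can be
  evaluated by rewriting.\<close>

type_synonym vec = "int \<times> int \<times> int"

fun dot :: "vec \<Rightarrow> vec \<Rightarrow> int" where
  "dot (a, b, c) (x, y, z) = a * x + b * y + c * z"

fun cross :: "vec \<Rightarrow> vec \<Rightarrow> vec" where
  "cross (a, b, c) (x, y, z) = (b * z - c * y, c * x - a * z, a * y - b * x)"

fun add :: "vec \<Rightarrow> vec \<Rightarrow> vec" where
  "add (a, b, c) (x, y, z) = (a + x, b + y, c + z)"

fun scale :: "int \<Rightarrow> vec \<Rightarrow> vec" where
  "scale k (x, y, z) = (k * x, k * y, k * z)"

fun height :: "vec \<Rightarrow> int" where
  "height (x, y, z) = x + y + z"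

definition det3 :: "vec \<Rightarrow> vec \<Rightarrow> vec \<Rightarrow> int" where
  "det3 a b c = dot a (cross b c)"

primrec vsum :: "vec list \<Rightarrow> vec" where
  "vsum [] = (0, 0, 0)"
| "vsum (x # xs) = add x (vsum xs)"

text \<open>Existential search that stops at the first witness also when it is evaluated by rewriting, since the
  branches of a conditional are not simplified before its condition. For the same reason conjunctions
  are written as conditionals in the following definitions.\<close>

primrec any :: "('a \<Rightarrow> bool) \<Rightarrow> 'a list \<Rightarrow> bool" where
  "any P [] = False"
| "any P (x # xs) = (if P x then True else any P xs)"

primrec sublist :: "vec list \<Rightarrow> vec list \<Rightarrow> bool" where
  "sublist [] ys = True"
| "sublist (x # xs) ys = (if x \<in> set ys then sublist xs ys else False)"

definition verts :: "vec list list \<Rightarrow> vec list" where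
  "verts F = remdups (concat F)"

text \<open>For a determinant of absolute value one this is the form equal to one on the three vectors:
  multiplication by the determinant replaces division by it.\<close>

definition tri_normal :: "vec list \<Rightarrow> vec" where
  "tri_normal f = (case f of [a, b, c] \<Rightarrow>
     scale (det3 a b c) (add (cross b c) (add (cross c a) (cross a b))) | _ \<Rightarrow> (0, 0, 0))"

definition unimodular :: "vec list \<Rightarrow> bool" where
  "unimodular f = (case f of [a, b, c] \<Rightarrow> \<bar>det3 a b c\<bar> = 1 | _ \<Rightarrow> False)"

definition beneath :: "vec \<Rightarrow> vec list \<Rightarrow> vec \<Rightarrow> bool" where
  "beneath m f v = (if dot m v \<le> 0 then True else v \<in> set f)"

definition facet_ok :: "vec list \<Rightarrow> vec list \<Rightarrow> bool" where
  "facet_ok vs f = (if unimodular f then list_all (beneath (tri_normal f) f) vs else False)"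

definition ridges_ok :: "vec list list \<Rightarrow> vec list \<Rightarrow> bool" where
  "ridges_ok F f = list_all (\<lambda>v. any (\<lambda>g. if v \<in> set g then False else sublist (removeAll v f) g) F) f"

definition fano_check :: "vec list list \<Rightarrow> bool" where
  "fano_check F = (if list_all (facet_ok (verts F)) F then list_all (ridges_ok F) F else False)"

definition same :: "vec list list \<Rightarrow> vec list list \<Rightarrow> bool" where
  "same F G = (if list_all (\<lambda>f. any (\<lambda>g. if sublist f g then sublist g f else False) G) F
     then list_all (\<lambda>g. any (\<lambda>f. if sublist f g then sublist g f else False) F) G else False)"

definition blow_up_data :: "vec list list \<Rightarrow> vec list \<Rightarrow> vec list list" where
  "blow_up_data F T = filter (\<lambda>f. \<not> sublist T f) F @
     concat (map (\<lambda>f. map (\<lambda>t. vsum T # removeAll t f) T) (filter (sublist T) F))"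

text \<open>The inverse of the blow-up along \<open>T\<close>: a facet containing the vertex \<open>vsum T\<close> and all of \<open>T\<close>
  but \<open>t\<close> had \<open>t\<close> in the place of that vertex. Nothing guarantees that the result is a Fano complex
  with the expected blow-up; a move is legal only if both are confirmed.\<close>

definition blow_down_data :: "vec list list \<Rightarrow> vec list \<Rightarrow> vec list list" where
  "blow_down_data F T = filter (\<lambda>f. vsum T \<notin> set f) F @
     concat (map (\<lambda>t. map (\<lambda>f. t # removeAll (vsum T) f)
       (filter (sublist (vsum T # removeAll t T)) F)) T)"

datatype move = Up "vec list" | Down "vec list"

definition blow_ok :: "vec list list \<Rightarrow> vec list \<Rightarrow> bool" where
  "blow_ok F T = (if T \<noteq> [] then if distinct T then any (sublist T) F else False else False)"

fun legal :: "move \<Rightarrow> vec list list \<Rightarrow> bool" where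
  "legal (Up T) F = (if blow_ok F T then fano_check (blow_up_data F T) else False)"
| "legal (Down T) F = (if fano_check (blow_down_data F T) then if blow_ok (blow_down_data F T) T
     then same (blow_up_data (blow_down_data F T) T) F else False else False)"

fun apply_move :: "move \<Rightarrow> vec list list \<Rightarrow> vec list list" where
  "apply_move (Up T) F = blow_up_data F T"
| "apply_move (Down T) F = blow_down_data F T"

primrec reduces :: "nat \<Rightarrow> move list \<Rightarrow> vec list list \<Rightarrow> bool" where
  "reduces N [] F = (length (verts F) < N)"
| "reduces N (m # ms) F = (if legal m F then reduces N ms (apply_move m F) else False)"

definition vertex_link :: "vec list list \<Rightarrow> vec \<Rightarrow> vec list" where
  "vertex_link F v = removeAll v (verts (filter (\<lambda>f. v \<in> set f) F))"

text \<open>Four toric Fano 3-folds other than \<open>\<bbbP>\<^sup>3\<close> are not blow-ups of toric Fano 3-folds: \<open>(\<bbbP>\<^sup>1)\<^sup>3\<close>, the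
  bundle \<open>\<bbbP>(\<O> \<oplus> \<O>(1,1))\<close> over \<open>\<bbbP>\<^sup>1 \<times> \<bbbP>\<^sup>1\<close>, \<open>\<bbbP>\<^sup>1 \<times> \<bbbP>\<^sup>2\<close>, and the bundle
  \<open>\<bbbP>(\<O> \<oplus> \<O>(2))\<close> over \<open>\<bbbP>\<^sup>2\<close>. In this order, the lists lead from each of them through one blow-up
  along a curve and two blow-downs to a variety with fewer ray generators. The vertices are those in the
  coordinates in which the enumeration meets these varieties.\<close>

definition detours :: "move list list" where
  "detours =
    [[Up [(-1,0,0), (0,-1,0)], Down [(-1,-1,0), (0,1,0)], Down [(-1,-1,0), (1,0,0)]],
     [Up [(-1,0,1), (0,0,-1)], Down [(-1,0,0), (0,0,1)], Down [(0,-1,1), (0,1,0)]],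
     [Up [(-1,0,0), (0,-1,-1)], Down [(-1,-1,-1), (1,0,0)], Down [(-1,-1,-1), (0,0,1), (0,1,0)]],
     [Up [(-1,-1,2), (0,0,-1)], Down [(-1,-1,1), (0,0,1)], Down [(-1,-1,1), (0,1,0), (1,0,0)]]]"

text \<open>The vertex of a blow-up is the sum of two vertices or, for the blow-up of a point, the sum of the three
  vertices in its link.\<close>

definition reductions :: "vec list list \<Rightarrow> move list list" where
  "reductions F = map (\<lambda>T. [Down T])
     (filter (\<lambda>T. vsum T \<in> set (verts F))
       (concat (map (\<lambda>a. map (\<lambda>b. [a, b]) (verts F)) (verts F)) @ map (vertex_link F) (verts F))) @ detours"

definition simplex_boundary :: "vec list list" where
  "simplex_boundary = [[(1,0,0), (0,1,0), (0,0,1)], [(-1,-1,-1), (0,1,0), (0,0,1)],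
     [(1,0,0), (-1,-1,-1), (0,0,1)], [(1,0,0), (0,1,0), (-1,-1,-1)]]"

text \<open>Only the simplex has four facets.\<close>

definition reducible :: "vec list list \<Rightarrow> bool" where
  "reducible F = (if length F = 4 then same F simplex_boundary
     else any (\<lambda>ms. reduces (length (verts F)) ms F) (reductions F))"

definition emb :: "vec \<Rightarrow> real^3" where
  "emb v = (case v of (x, y, z) \<Rightarrow> vector [of_int x, of_int y, of_int z])"

lemma emb_nth: "emb (x, y, z) $ 1 = of_int x" "emb (x, y, z) $ 2 = of_int y" "emb (x, y, z) $ 3 = of_int z"
  by (simp_all add: emb_def)

lemma emb_eq_iff [simp]: "emb v = emb w \<longleftrightarrow> v = w"
  by (cases v; cases w) (auto simp: vec_eq_iff forall_3 emb_nth)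

lemma inj_emb: "inj emb"
  by (simp add: inj_def)

lemma emb_add: "emb (add v w) = emb v + emb w"
  by (cases v; cases w) (simp add: vec_eq_iff forall_3 emb_nth)

lemma emb_scale: "emb (scale k v) = of_int k *\<^sub>R emb v"
  by (cases v) (simp add: vec_eq_iff forall_3 emb_nth)

lemma emb_zero: "emb (0, 0, 0) = 0"
  by (simp add: vec_eq_iff forall_3 emb_nth)

lemma emb_vsum: "distinct T \<Longrightarrow> emb (vsum T) = \<Sum>(emb ` set T)"
  by (induction T) (simp_all add: emb_zero emb_add inj_image_mem_iff[OF inj_emb])

lemma emb_inner: "emb v \<bullet> emb w = of_int (dot v w)"
  by (cases v; cases w) (simp add: inner_vec_def sum_3 emb_nth)

lemma range_emb: "range emb = std_lattice"
proof (intro subset_antisym subsetI)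
  fix x :: "real^3" assume "x \<in> std_lattice"
  then have "x $ 1 \<in> \<int>" "x $ 2 \<in> \<int>" "x $ 3 \<in> \<int>" by (simp_all add: std_lattice_def)
  then obtain i j k where "x $ 1 = of_int i" "x $ 2 = of_int j" "x $ 3 = of_int k"
    by (auto elim!: Ints_cases)
  then have "x = emb (i, j, k)" by (simp add: vec_eq_iff forall_3 emb_nth)
  then show "x \<in> range emb" by blast
next
  fix x assume "x \<in> range emb"
  then obtain i j k where "x = emb (i, j, k)" by auto
  then show "x \<in> std_lattice" by (auto simp: std_lattice_def forall_3 emb_nth)
qed

definition comb :: "int \<Rightarrow> int \<Rightarrow> int \<Rightarrow> vec \<Rightarrow> vec \<Rightarrow> vec \<Rightarrow> vec" where
  "comb i j k a b c = add (scale i a) (add (scale j b) (scale k c))"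

lemma det3_degenerate: "det3 a a b = 0" "det3 a b a = 0" "det3 b a a = 0"
  by (cases a; cases b; simp add: det3_def algebra_simps)+

lemma abs_eq_1_square: "\<bar>d\<bar> = 1 \<Longrightarrow> d * d = (1::int)"
  by (simp add: abs_if split: if_splits)

text \<open>Cramer's rule, multiplied out to stay integral.\<close>

lemma cramer: "scale (det3 a b c) v = comb (det3 v b c) (det3 a v c) (det3 a b v) a b c"
  by (cases a; cases b; cases c; cases v) (simp add: comb_def det3_def algebra_simps)

lemma det3_comb:
  "det3 (comb i j k a b c) (comb i' j' k' a b c) (comb i'' j'' k'' a b c)
    = det3 (i, j, k) (i', j', k') (i'', j'', k'') * det3 a b c"
  by (cases a; cases b; cases c) (simp add: comb_def det3_def algebra_simps)

lemma emb_comb: "emb (comb i j k a b c) = of_int i *\<^sub>R emb a + of_int j *\<^sub>R emb b + of_int k *\<^sub>R emb c"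
  by (simp add: comb_def emb_add emb_scale)

lemma unimodular_imp_lattice_basis:
  assumes d: "\<bar>det3 a b c\<bar> = 1"
  shows "lattice_basis (emb ` {a, b, c})"
proof -
  let ?B = "emb ` {a, b, c}"
  have ne: "a \<noteq> b" "b \<noteq> c" "a \<noteq> c" using d det3_degenerate by (metis abs_zero zero_neq_one)+
  have rep: "v = comb (det3 a b c * det3 v b c) (det3 a b c * det3 a v c) (det3 a b c * det3 a b v) a b c" for v
  proof -
    have "det3 a b c * det3 a b c = 1" using d by (rule abs_eq_1_square)
    then have "v = scale (det3 a b c) (scale (det3 a b c) v)" 
      by (cases v) (simp add: mult.assoc[symmetric])
    also have "\<dots> = scale (det3 a b c) (comb (det3 v b c) (det3 a v c) (det3 a b v) a b c)"
      by (simp only: cramer)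
    finally show ?thesis
      by (cases a; cases b; cases c) (simp add: comb_def algebra_simps)
  qed
  have sum: "(\<Sum>x\<in>?B. of_int (f x) *\<^sub>R x) = emb (comb (f (emb a)) (f (emb b)) (f (emb c)) a b c)" for f :: "_ \<Rightarrow> int"
    using ne by (simp add: emb_comb add.assoc)
  have "{\<Sum>x\<in>?B. of_int (f x) *\<^sub>R x | f :: _ \<Rightarrow> int. True} = std_lattice"
  proof (intro subset_antisym subsetI)
    fix x :: "real^3" assume "x \<in> std_lattice"
    then obtain v where v: "x = emb v" using range_emb by blast
    define f where "f = (\<lambda>y. if y = emb a then det3 a b c * det3 v b c
      else if y = emb b then det3 a b c * det3 a v c else det3 a b c * det3 a b v)"
    have "x = (\<Sum>x\<in>?B. of_int (f x) *\<^sub>R x)"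
      unfolding sum v using rep[of v] ne by (simp add: f_def)
    then show "x \<in> {\<Sum>x\<in>?B. of_int (f x) *\<^sub>R x | f :: _ \<Rightarrow> int. True}" by blast
  next
    fix x assume "x \<in> {\<Sum>x\<in>?B. of_int (f x) *\<^sub>R x | f :: _ \<Rightarrow> int. True}"
    then obtain f :: "_ \<Rightarrow> int" where "x = (\<Sum>x\<in>?B. of_int (f x) *\<^sub>R x)" by blast
    then show "x \<in> std_lattice" unfolding sum range_emb[symmetric] by blast
  qed
  moreover have "independent ?B"
  proof (rule card_le_dim_spanning[of _ UNIV])
    have "emb v \<in> span ?B" for v
      by (subst rep[of v], unfold emb_comb, intro span_add span_scale span_base) auto
    then have "std_lattice \<subseteq> span ?B" unfolding range_emb[symmetric] by blast
    then have "Basis \<subseteq> span ?B" using axis_in_std_lattice by (auto simp: Basis_vec_def)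
    then show "UNIV \<subseteq> span ?B" using span_minimal[OF _ subspace_span, of Basis ?B] by simp
    have "card ?B \<le> card {a, b, c}" by (rule card_image_le) simp
    also have "card {a, b, c} \<le> 3" by (simp add: card_insert_if)
    finally have "card ?B \<le> 3" .
    then show "card ?B \<le> dim (UNIV :: (real^3) set)" by simp
  qed auto
  ultimately show ?thesis by (simp add: lattice_basis_def)
qed

text \<open>The standard basis consists of integral combinations of a lattice basis, so the determinant of the
  lattice basis divides one.\<close>

lemma lattice_basis_imp_unimodular:
  assumes B: "lattice_basis (emb ` {a, b, c})"
  shows "\<bar>det3 a b c\<bar> = 1"
proof -
  have "card {a, b, c} = card (emb ` {a, b, c})"
    by (rule card_image[OF inj_on_subset[OF inj_emb], symmetric]) simp
  also have "\<dots> = 3" using lattice_basis_card[OF B] by simp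
  finally have "card {a, b, c} = 3" .
  then have ne: "a \<noteq> b" "b \<noteq> c" "a \<noteq> c" by (auto simp: card_insert_if split: if_splits)
  have "\<exists>i j k. v = comb i j k a b c" for v
  proof -
    have "emb v \<in> std_lattice" using range_emb by blast
    then obtain f :: "_ \<Rightarrow> int" where "emb v = (\<Sum>x\<in>emb ` {a, b, c}. of_int (f x) *\<^sub>R x)"
      by (rule lattice_basis_coefficients[OF B])
    also have "\<dots> = emb (comb (f (emb a)) (f (emb b)) (f (emb c)) a b c)"
      using ne by (simp add: emb_comb add.assoc)
    finally have "v = comb (f (emb a)) (f (emb b)) (f (emb c)) a b c" by simp
    then show ?thesis by blast
  qed note combs = this
  obtain i j k where 1: "(1,0,0) = comb i j k a b c" using combs by blast
  obtain i' j' k' where 2: "(0,1,0) = comb i' j' k' a b c" using combs by blast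
  obtain i'' j'' k'' where 3: "(0,0,1) = comb i'' j'' k'' a b c" using combs by blast
  have "det3 (1,0,0) (0,1,0) (0,0,1) = det3 (i, j, k) (i', j', k') (i'', j'', k'') * det3 a b c"
    unfolding 1 2 3 by (rule det3_comb)
  then have "det3 (i, j, k) (i', j', k') (i'', j'', k'') * det3 a b c = 1" by (simp add: det3_def)
  then show ?thesis by (auto simp: zmult_eq_1_iff)
qed

lemma facet_normal_emb:
  assumes "lattice_basis (emb ` f)" "\<And>x. x \<in> f \<Longrightarrow> dot m x = 1"
  shows "facet_normal (emb ` f) = emb m"
  by (rule facet_normal_unique[OF assms(1), symmetric]) (auto simp: emb_inner assms(2))

definition complex_of :: "vec list list \<Rightarrow> (real^3) set set" where
  "complex_of F = (\<lambda>f. emb ` set f) ` set F"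

lemma any_iff [simp]: "any P xs \<longleftrightarrow> (\<exists>x\<in>set xs. P x)"
  by (induction xs) auto

lemma sublist_iff [simp]: "sublist xs ys \<longleftrightarrow> set xs \<subseteq> set ys"
  by (induction xs) auto

lemma set_verts: "set (verts F) = \<Union>(set ` set F)"
  by (auto simp: verts_def)

lemma Union_complex_of: "\<Union>(complex_of F) = emb ` set (verts F)"
  by (auto simp: complex_of_def set_verts)

lemma card_vertices_complex_of: "card (\<Union>(complex_of F)) = length (verts F)"
proof -
  have "card (\<Union>(complex_of F)) = card (set (verts F))"
    unfolding Union_complex_of by (intro card_image inj_on_subset[OF inj_emb]) simp
  also have "\<dots> = length (verts F)" by (rule distinct_card) (simp add: verts_def)
  finally show ?thesis .
qed

lemma emb_image_subset_iff [simp]: "emb ` A \<subseteq> emb ` B \<longleftrightarrow> A \<subseteq> B"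
  by (simp add: inj_image_subset_iff[OF inj_emb])

lemma unimodularE:
  assumes "unimodular f"
  obtains a b c where "f = [a, b, c]" "\<bar>det3 a b c\<bar> = 1"
  using assms unfolding unimodular_def by (auto split: list.splits)

lemma dot_tri_normal:
  assumes "unimodular f" "x \<in> set f"
  shows "dot (tri_normal f) x = 1"
proof -
  obtain a b c where f: "f = [a, b, c]" "\<bar>det3 a b c\<bar> = 1" using assms(1) by (rule unimodularE)
  have "dot (tri_normal f) x = det3 a b c * (det3 x b c + det3 a x c + det3 a b x)"
    by (cases a; cases b; cases c; cases x) (simp add: f tri_normal_def det3_def algebra_simps)
  also have "\<dots> = det3 a b c * det3 a b c" using assms(2) f(1) by (auto simp: det3_degenerate)
  also have "\<dots> = 1" using f(2) by (rule abs_eq_1_square)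
  finally show ?thesis .
qed

lemma fano_complex_complex_of:
  assumes F: "fano_check F" "F \<noteq> []"
  shows "fano_complex (complex_of F)"
  unfolding fano_complex_def
proof (intro conjI ballI)
  show "finite (complex_of F)" "complex_of F \<noteq> {}" using F(2) by (simp_all add: complex_of_def)
  fix S assume "S \<in> complex_of F"
  then obtain f where f: "f \<in> set F" "S = emb ` set f" by (auto simp: complex_of_def)
  have ok: "unimodular f" "\<And>v. v \<in> set (verts F) \<Longrightarrow> v \<notin> set f \<Longrightarrow> dot (tri_normal f) v \<le> 0"
    using F(1) f(1) by (auto simp: fano_check_def facet_ok_def beneath_def list_all_iff split: if_splits)
  show b: "lattice_basis S"
    using ok(1) unimodular_imp_lattice_basis f(2) by (auto elim!: unimodularE)
  have n: "facet_normal S = emb (tri_normal f)"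
    using b dot_tri_normal[OF ok(1)] unfolding f(2) by (intro facet_normal_emb)
  {
    fix v assume "v \<in> \<Union>(complex_of F) - S"
    then obtain w where "v = emb w" "w \<in> set (verts F)" "w \<notin> set f"
      unfolding Union_complex_of f(2) by auto
    then show "facet_normal S \<bullet> v \<le> 0" using ok(2) by (simp add: n emb_inner)
  }
  fix v assume "v \<in> S"
  then obtain w where w: "v = emb w" "w \<in> set f" using f(2) by blast
  obtain g where g: "g \<in> set F" "w \<notin> set g" "set f - {w} \<subseteq> set g"
    using F(1) f(1) w(2) by (auto simp: fano_check_def ridges_ok_def list_all_iff split: if_splits)
  then have "S \<inter> emb ` set g = S - {v}" unfolding f(2) w(1) by (auto simp: image_iff)
  then show "\<exists>S'\<in>complex_of F. S \<inter> S' = S - {v}" using g(1) by (auto simp: complex_of_def)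
qed

lemma same_imp_complex_of_eq:
  assumes "same F G"
  shows "complex_of F = complex_of G"
proof -
  have "set ` set F = set ` set G"
    using assms by (auto simp: same_def list_all_iff image_iff split: if_splits) (metis subset_antisym)+
  then have "(\<lambda>A. emb ` A) ` set ` set F = (\<lambda>A. emb ` A) ` set ` set G" by (rule arg_cong)
  then show ?thesis by (simp add: complex_of_def image_image)
qed

lemma complex_of_blow_up_data:
  assumes "distinct T"
  shows "complex_of (blow_up_data F T) = blow_up (complex_of F) (emb ` set T)"
proof -
  have new: "emb ` set (vsum T # removeAll t f) = insert (\<Sum>(emb ` set T)) (emb ` set f - {emb t})" for t f
    by (simp add: emb_vsum[OF assms] image_set_diff[OF inj_emb])
  show ?thesis
  proof (intro subset_antisym subsetI)
    fix S assume "S \<in> complex_of (blow_up_data F T)"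
    then obtain g where g: "g \<in> set (blow_up_data F T)" "S = emb ` set g" by (auto simp: complex_of_def)
    then consider "g \<in> set F" "\<not> set T \<subseteq> set g" 
      | f t where "f \<in> set F" "set T \<subseteq> set f" "t \<in> set T" "g = vsum T # removeAll t f"
      by (auto simp: blow_up_data_def)
    then show "S \<in> blow_up (complex_of F) (emb ` set T)"
    proof cases
      case 1
      then show ?thesis using g(2) by (auto simp: blow_up_def complex_of_def)
    next
      case 2
      have "insert (\<Sum>(emb ` set T)) (emb ` set f - {emb t}) \<in> blow_up (complex_of F) (emb ` set T)"
        using 2 by (intro blow_up_newI) (auto simp: complex_of_def)
      then show ?thesis unfolding g(2) 2(4) new .
    qed
  next
    fix S assume "S \<in> blow_up (complex_of F) (emb ` set T)"
    then consider f where "f \<in> set F" "S = emb ` set f" "\<not> set T \<subseteq> set f"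
      | f t where "f \<in> set F" "set T \<subseteq> set f" "t \<in> set T" "S = insert (\<Sum>(emb ` set T)) (emb ` set f - {emb t})"
      unfolding blow_up_def complex_of_def by auto
    then show "S \<in> complex_of (blow_up_data F T)"
    proof cases
      case 1
      then show ?thesis by (auto simp: complex_of_def blow_up_data_def)
    next
      case 2
      then have "vsum T # removeAll t f \<in> set (blow_up_data F T)" by (auto simp: blow_up_data_def)
      then show ?thesis unfolding 2(4) new[symmetric] complex_of_def by blast
    qed
  qed
qed

lemma blow_okE:
  assumes "blow_ok F T"
  obtains f where "distinct T" "f \<in> set F" "set T \<subseteq> set f" "T \<noteq> []"
  using assms unfolding blow_ok_def by (auto split: if_splits)

text \<open>A legal move is a Fano blow-up read in one of the two directions.\<close>

lemma legal_move_F_equivalent: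
  assumes K: "fano_complex (complex_of F)" and m: "legal m F"
  shows "fano_complex (complex_of (apply_move m F)) \<and>
    (\<forall>X. F_equivalent (fan_of (complex_of (apply_move m F))) X \<longrightarrow> F_equivalent (fan_of (complex_of F)) X)"
proof (cases m)
  case (Up T)
  then have ok: "blow_ok F T" "fano_check (blow_up_data F T)" using m by (auto split: if_splits)
  from ok(1) obtain f where f: "distinct T" "f \<in> set F" "set T \<subseteq> set f" "T \<noteq> []" by (rule blow_okE)
  note eq = complex_of_blow_up_data[OF f(1), of F]
  have "blow_up_data F T \<noteq> []" using f by (cases T) (auto simp: blow_up_data_def filter_empty_conv)
  then have K': "fano_complex (complex_of (blow_up_data F T))" using ok(2) by (rule fano_complex_complex_of[rotated])
  have "F_equivalent (fan_of (complex_of F)) X" if "F_equivalent (fan_of (complex_of (blow_up_data F T))) X" for X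
    using that f K' unfolding eq
    by (intro F_equivalent_via_blow_up[OF K, of "emb ` set T" "emb ` set f"]) (auto simp: complex_of_def)
  then show ?thesis using Up K' by simp
next
  case (Down T)
  let ?G = "blow_down_data F T"
  have ok: "fano_check ?G" "blow_ok ?G T" "same (blow_up_data ?G T) F" using Down m by (auto split: if_splits)
  from ok(2) obtain f where f: "distinct T" "f \<in> set ?G" "set T \<subseteq> set f" "T \<noteq> []" by (rule blow_okE)
  have eq: "blow_up (complex_of ?G) (emb ` set T) = complex_of F"
    using complex_of_blow_up_data[OF f(1), of ?G] same_imp_complex_of_eq[OF ok(3)] by simp
  have K': "fano_complex (complex_of ?G)" using ok(1) f(2) by (intro fano_complex_complex_of) auto
  have "F_equivalent (fan_of (complex_of F)) X" if "F_equivalent (fan_of (complex_of ?G)) X" for X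
    unfolding eq[symmetric]
    by (rule F_equivalent_via_blow_down[OF K' _ _ _ _ that, of _ "emb ` set f"])
      (use K f eq in \<open>auto simp: complex_of_def\<close>)
  then show ?thesis using Down K' by simp
qed

lemma reduces_F_equivalent:
  assumes "reduces N ms F" "fano_complex (complex_of F)"
  shows "\<exists>G. fano_complex (complex_of G) \<and> length (verts G) < N \<and>
    (\<forall>X. F_equivalent (fan_of (complex_of G)) X \<longrightarrow> F_equivalent (fan_of (complex_of F)) X)"
  using assms
proof (induction ms arbitrary: F)
  case Nil
  then show ?case by auto
next
  case (Cons m ms)
  then have m: "legal m F" "reduces N ms (apply_move m F)" by (auto split: if_splits)
  then show ?case using Cons.IH[OF m(2)] legal_move_F_equivalent[OF Cons.prems(2) m(1)] by blast
qed

section \<open>Enumeration of the triangulations\<close>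

definition unit_vecs :: "vec list" where
  "unit_vecs = [(1,0,0), (0,1,0), (0,0,1)]"

text \<open>A facet is stored with its normal. A ridge \<open>(m, p, q, r)\<close> is the edge \<open>q r\<close> of the facet \<open>p q r\<close>
  with normal \<open>m\<close>. A state consists of the vertices and facets found so far, the ridges contained in only one
  of these facets, and the points that may still turn out to be vertices.\<close>

type_synonym facet = "vec \<times> vec list"
type_synonym ridge = "vec \<times> vec \<times> vec \<times> vec"
type_synonym state = "vec list \<times> facet list \<times> ridge list \<times> vec list"

text \<open>Necessary conditions for \<open>w\<close> to span the facet on the other side of the ridge. Here \<open>u\<close> is the form
  that is one at \<open>p\<close> and zero on the ridge. So \<open>w\<close> has to take the value \<open>-1\<close>, and the normal of the new
  facet is \<open>m + (m \<cdot> w - 1) u\<close>. The last condition bounds the number of vertices: heights of vertices other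
  than unit vectors are nonpositive and all heights together are nonnegative.\<close>

definition admissible :: "vec list \<Rightarrow> facet list \<Rightarrow> ridge \<Rightarrow> vec \<Rightarrow> vec \<Rightarrow> bool" where
  "admissible V F \<rho> u w = (case \<rho> of (m, p, q, r) \<Rightarrow>
     if dot u w = -1 then 
     if list_all (\<lambda>(n, f). beneath n f w) F then 
     if list_all (beneath (add m (scale (dot m w - 1) u)) [w, q, r]) V then 
       0 \<le> sum_list (map height (List.insert w V)) else False else False else False)"

fun is_open :: "facet list \<Rightarrow> ridge \<Rightarrow> bool" where
  "is_open F (m, p, q, r) = (\<not> any (\<lambda>(n, f). if q \<in> set f then if r \<in> set f then p \<notin> set f else False else False) F)"

definition extend :: "state \<Rightarrow> vec \<Rightarrow> vec \<Rightarrow> vec \<Rightarrow> vec \<Rightarrow> state" where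
  "extend st m w q r = (case st of (V, F, E, C) \<Rightarrow>
     (List.insert w V, (m, [w, q, r]) # F, filter (is_open ((m, [w, q, r]) # F)) (E @ [(m, q, w, r), (m, r, w, q)]),
      filter (\<lambda>v. if v = w then False else dot m v \<le> 0) C))"

text \<open>All choices for the vertex opposite to a ridge, with the bound \<open>h\<close> on its height. The
  continuation \<open>k\<close> receives the vertex and the extended state.\<close>

definition branch :: "int \<Rightarrow> (vec \<Rightarrow> state \<Rightarrow> bool) \<Rightarrow> state \<Rightarrow> ridge \<Rightarrow> vec \<Rightarrow> bool" where
  "branch h k st \<rho> u = (case st of (V, F, E, C) \<Rightarrow> case \<rho> of (m, p, q, r) \<Rightarrow>
     list_all (\<lambda>w. if height w \<le> h then if admissible V F (m, p, q, r) u w then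
        k w (extend (V, F, E, C) (add m (scale (dot m w - 1) u)) w q r) else True else True) (V @ C))"

fun ridge_dual :: "ridge \<Rightarrow> vec" where
  "ridge_dual (m, p, q, r) = scale (det3 p q r) (cross q r)"

text \<open>The first argument limits the depth of the recursion. Reaching the limit counts as failure, so a positive
  answer does not depend on it.\<close>

primrec search :: "nat \<Rightarrow> state \<Rightarrow> bool" where
  "search 0 st = False"
| "search (Suc n) st = (case st of (V, F, E, C) \<Rightarrow> case E of [] \<Rightarrow> reducible (map snd F)
    | \<rho> # E' \<Rightarrow> branch 1 (\<lambda>w. search n) (V, F, E', C) \<rho> (ridge_dual \<rho>))"

text \<open>With all coordinates at least \<open>h - 1\<close> and sum \<open>h\<close>, each coordinate is at most \<open>2 - h\<close>, so this covers
  all integral points of height \<open>h\<close> satisfying the lower bounds.\<close>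

definition candidates :: "vec list" where 
  "candidates = concat (map (\<lambda>h. concat (map (\<lambda>x. map (\<lambda>y. (x, y, h - x - y))
      (filter (\<lambda>y. h - 1 \<le> h - x - y) [h-1..2-h])) [h-1..2-h])) [0,-1,-2,-3])"

text \<open>The three neighbours of the standard facet are chosen with decreasing heights, which removes most of the
  symmetry under permutations of the coordinates.\<close>

definition enumeration :: bool where
  "enumeration = branch 1 (\<lambda>w1 s1. branch (height w1) (\<lambda>w2 s2. branch (height w2) (\<lambda>w3 s3. search 20 s3)
     s2 ((1,1,1), (0,0,1), (1,0,0), (0,1,0)) (0,0,1))
     s1 ((1,1,1), (0,1,0), (1,0,0), (0,0,1)) (0,1,0))
     ([(1,0,0), (0,1,0), (0,0,1)], [((1,1,1), [(1,0,0), (0,1,0), (0,0,1)])], [], candidates)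
     ((1,1,1), (1,0,0), (0,1,0), (0,0,1)) (1,0,0)"

text \<open>Every triangulation that the search completes is the boundary of the simplex or can be moved to one
  with fewer vertices.\<close>

lemma enumeration_succeeds: enumeration
  by code_simp

lemma dot_add: "dot m (add v w) = dot m v + dot m w" "dot (add m n) v = dot m v + dot n v"
  by (cases m; cases n; cases v; cases w; simp add: algebra_simps)+

lemma dot_scale: "dot m (scale k v) = k * dot m v" "dot (scale k m) v = k * dot m v"
  by (cases m; cases v; simp add: algebra_simps)+

lemma dot_comb: "dot m (comb i j k a b c) = i * dot m a + j * dot m b + k * dot m c"
  by (simp add: comb_def dot_add dot_scale)

lemma height_eq_dot: "height v = dot (1, 1, 1) v"
  by (cases v) simp

lemma dot_ridge_dual: "dot (ridge_dual (m, p, q, r)) v = det3 p q r * det3 v q r"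
  by (cases q; cases r; cases v) (simp add: dot_scale det3_def algebra_simps)

definition supports :: "(real^3) set set \<Rightarrow> vec \<Rightarrow> vec set \<Rightarrow> bool" where
  "supports K m f \<longleftrightarrow> emb ` f \<in> K \<and> (\<forall>x\<in>f. dot m x = 1)"

text \<open>The invariants of the search relative to a fixed Fano complex \<open>K\<close>: the facets of the state belong to \<open>K\<close>,
  the vertices of \<open>K\<close> are among the known ones and the candidates, and each edge of a known facet is
  shared with another known facet or still listed. The set \<open>X\<close> holds ridges scheduled outside the state.\<close>

fun vertex_invariant :: "(real^3) set set \<Rightarrow> state \<Rightarrow> bool" where
  "vertex_invariant K (V, F, E, C) \<longleftrightarrow>
     (\<forall>(m, f)\<in>set F. supports K m (set f)) \<and> set V = \<Union>((\<lambda>x. set (snd x)) ` set F) \<and> distinct V \<and>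
     \<Union>K \<subseteq> emb ` (set V \<union> set C) \<and> set unit_vecs \<subseteq> set V"

fun ridge_invariant :: "ridge set \<Rightarrow> state \<Rightarrow> bool" where
  "ridge_invariant X (V, F, E, C) \<longleftrightarrow>
     (\<forall>(m, p, q, r) \<in> set E \<union> X. \<exists>f. (m, f) \<in> set F \<and> set f = {p, q, r}) \<and>
     (\<forall>(m, f)\<in>set F. \<forall>v\<in>set f. (\<exists>(n, g)\<in>set F. v \<notin> set g \<and> set f - {v} \<subseteq> set g) \<or>
        (\<exists>(n, p, q, r)\<in>set E \<union> X. set f = {p, q, r} \<and> v = p))"

definition heights_ok :: "(real^3) set set \<Rightarrow> bool" where
  "heights_ok K \<longleftrightarrow> supports K (1, 1, 1) (set unit_vecs) \<and> 0 \<le> (\<Sum>v | emb v \<in> \<Union>K. height v)"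

context
  fixes K :: "(real^3) set set"
  assumes K: "fano_complex K"
begin

lemma emb_vertices: "\<Union>K = emb ` {v. emb v \<in> \<Union>K}"
proof -
  have "\<Union>K \<subseteq> range emb" using complex_basis[OF K] lattice_basis_subset range_emb by blast
  then show ?thesis by blast
qed

lemma finite_vertices: "finite {v. emb v \<in> \<Union>K}"
  using complex_vertices_finite[OF K] finite_vimageI[OF _ inj_emb, of "\<Union>K"] by (simp add: vimage_def)

lemma supports_le_0:
  assumes "supports K m f" "emb v \<in> \<Union>K" "v \<notin> f"
  shows "dot m v \<le> 0"
proof -
  have f: "emb ` f \<in> K" using assms(1) by (simp add: supports_def)
  have "facet_normal (emb ` f) = emb m"
    using assms(1) complex_basis[OF K f] by (intro facet_normal_emb) (auto simp: supports_def)
  moreover have "emb v \<notin> emb ` f" using assms(3) by auto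
  ultimately show ?thesis using complex_normal_le_0[OF K f assms(2)] by (simp add: emb_inner)
qed

lemma supports_le_1:
  assumes "supports K m f" "emb v \<in> \<Union>K"
  shows "dot m v \<le> 1"
  using supports_le_0[OF assms] assms(1) by (cases "v \<in> f") (auto simp: supports_def)

lemma facet_det: "emb ` {a, b, c} \<in> K \<Longrightarrow> \<bar>det3 a b c\<bar> = 1"
  using complex_basis[OF K] lattice_basis_imp_unimodular by blast

lemma facet_neighbour:
  assumes "emb ` {p, q, r} \<in> K"
  obtains w where "emb ` {w, q, r} \<in> K" "w \<notin> {p, q, r}"
proof -
  have d: "\<bar>det3 p q r\<bar> = 1" by (rule facet_det[OF assms])
  have "p \<noteq> q" "p \<noteq> r" using d det3_degenerate by (metis abs_zero zero_neq_one)+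
  then have "emb ` {p, q, r} - {emb p} = emb ` {q, r}" by auto
  moreover obtain x where x: "x \<notin> emb ` {p, q, r}" "insert x (emb ` {p, q, r} - {emb p}) \<in> K"
    by (rule complex_neighbour_vertex[OF K assms, of "emb p"]) simp_all
  moreover have "x \<in> \<Union>K" using x(2) by blast
  then obtain w where "x = emb w" using emb_vertices by blast
  ultimately show ?thesis using that[of w] by auto
qed

text \<open>The third vertices of two facets meeting in a ridge lie on opposite sides of it: otherwise
  each normal would be at most zero on the other vertex while the two values add up to two.\<close>

lemma neighbour_det:
  assumes f: "supports K m {p, q, r}" and g: "emb ` {w, q, r} \<in> K" and w: "w \<notin> {p, q, r}"
  shows "det3 p q r * det3 w q r = - 1"
proof -
  define n where "n = tri_normal [w, q, r]"
  have fK: "emb ` {p, q, r} \<in> K" using f by (simp add: supports_def)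
  note d = facet_det[OF fK] and d' = facet_det[OF g]
  have pqr: "p \<noteq> q" "p \<noteq> r" using d det3_degenerate by (metis abs_zero zero_neq_one)+
  have "unimodular [w, q, r]" using d' by (simp add: unimodular_def)
  then have n: "dot n x = 1" if "x \<in> {w, q, r}" for x
    unfolding n_def using that by (intro dot_tri_normal) auto
  have gn: "supports K n {w, q, r}" using g n by (simp add: supports_def)
  have m: "dot m p = 1" "dot m q = 1" "dot m r = 1" using f by (auto simp: supports_def)
  have "emb w \<in> \<Union>K" "emb p \<in> \<Union>K" using g fK by auto
  moreover have "p \<notin> {w, q, r}" using w pqr by blast
  ultimately have le: "dot m w \<le> 0" "dot n p \<le> 0"
    using supports_le_0[OF f _ w] supports_le_0[OF gn] by blast+
  have "det3 p q r \<noteq> det3 w q r"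
  proof
    assume eq: "det3 p q r = det3 w q r"
    have "det3 p q r * dot m w = dot m (scale (det3 p q r) w)" by (simp add: dot_scale)
    also have "\<dots> = det3 w q r + det3 p w r + det3 p q w" unfolding cramer by (simp add: dot_comb m)
    finally have 1: "det3 p q r * dot m w = det3 w q r + det3 p w r + det3 p q w" .
    have "det3 p q r * dot n w = dot n (scale (det3 p q r) w)" by (simp add: dot_scale)
    also have "\<dots> = det3 w q r * dot n p + det3 p w r + det3 p q w" unfolding cramer by (simp add: dot_comb n)
    finally have 2: "det3 p q r * dot n w = det3 w q r * dot n p + det3 p w r + det3 p q w" .
    have "dot n w = 1" by (simp add: n)
    then have "det3 p q r * (dot m w + dot n p) = det3 p q r * 2"
      using 1 2 eq by (simp add: algebra_simps)
    then have "dot m w + dot n p = 2" using d by auto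
    then show False using le by simp
  qed
  then show ?thesis using d d' by (auto simp: abs_if split: if_splits)
qed

text \<open>The two normals differ by a multiple of the form vanishing on the common ridge.\<close>

lemma neighbour_supports:
  assumes pqr: "supports K m {p, q, r}" and w: "emb ` {w, q, r} \<in> K" "w \<notin> {p, q, r}"
  shows "supports K (add m (scale (dot m w - 1) (ridge_dual (m, p, q, r)))) {w, q, r}"
proof -
  have "dot (ridge_dual (m, p, q, r)) q = 0" "dot (ridge_dual (m, p, q, r)) r = 0"
    "dot (ridge_dual (m, p, q, r)) w = - 1"
    using neighbour_det[OF pqr w] by (simp_all add: dot_ridge_dual det3_degenerate del: ridge_dual.simps)
  then show ?thesis
    using pqr w(1) by (auto simp: supports_def dot_add dot_scale simp del: ridge_dual.simps)
qed

context
  assumes heights: "heights_ok K"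
begin

lemma height_le_1: "emb v \<in> \<Union>K \<Longrightarrow> height v \<le> 1"
  using supports_le_1[of "(1, 1, 1)" "set unit_vecs" v] heights
  by (simp add: heights_ok_def height_eq_dot)

text \<open>Vertices outside the standard facet only lower the total height.\<close>

lemma sum_heights_nonneg:
  assumes A: "set unit_vecs \<subseteq> A" "emb ` A \<subseteq> \<Union>K"
  shows "0 \<le> (\<Sum>v\<in>A. height v)"
proof -
  let ?B = "{v. emb v \<in> \<Union>K}"
  have "height v \<le> 0" if "v \<in> ?B - A" for v
    using that A(1) heights supports_le_0[of "(1, 1, 1)" "set unit_vecs" v]
    by (auto simp: heights_ok_def height_eq_dot)
  then have "(\<Sum>v\<in>?B - A. height v) \<le> 0" by (rule sum_nonpos)
  moreover have "(\<Sum>v\<in>?B. height v) = (\<Sum>v\<in>?B - A. height v) + (\<Sum>v\<in>A. height v)"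
    using A(2) finite_vertices by (intro sum.subset_diff) auto
  ultimately show ?thesis using heights by (simp add: heights_ok_def)
qed

text \<open>The true neighbour across a ridge passes all tests, and the state extended by it satisfies the
  invariants again.\<close>

lemma extend_sound:
  assumes inv: "vertex_invariant K (V, F, E, C)" and ridges: "ridge_invariant (insert (m, p, q, r) X) (V, F, E, C)"
    and w: "emb ` {w, q, r} \<in> K" "w \<notin> {p, q, r}"
  defines "u \<equiv> ridge_dual (m, p, q, r)"
  defines "m' \<equiv> add m (scale (dot m w - 1) u)"
  shows "w \<in> set (V @ C)" "admissible V F (m, p, q, r) u w"
    "vertex_invariant K (extend (V, F, E, C) m' w q r)"
    "ridge_invariant X (extend (V, F, E, C) m' w q r)"
proof -
  have supp: "supports K n (set g)" if "(n, g) \<in> set F" for n g using inv that by auto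
  have V: "set V = \<Union>((\<lambda>x. set (snd x)) ` set F)" and dist: "distinct V"
    and KVC: "\<Union>K \<subseteq> emb ` (set V \<union> set C)" and es: "set unit_vecs \<subseteq> set V"
    using inv unfolding vertex_invariant.simps by blast+
  obtain f where f: "(m, f) \<in> set F" "set f = {p, q, r}" using ridges by auto
  have pqr: "supports K m {p, q, r}" using supp[OF f(1)] f(2) by simp
  have fV: "{p, q, r} \<subseteq> set V" unfolding V f(2)[symmetric] using f(1) by force
  have wK: "emb w \<in> \<Union>K" by (rule UnionI[OF w(1)]) simp
  have VK: "emb v \<in> \<Union>K" if v: "v \<in> set V" for v
  proof -
    obtain x where x: "x \<in> set F" "v \<in> set (snd x)" using v unfolding V by blast
    define n g where "n = fst x" and "g = snd x"
    have g: "(n, g) \<in> set F" "v \<in> set g" using x by (simp_all add: n_def g_def)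
    then have "supports K n (set g)" by (intro supp)
    then have "emb ` set g \<in> K" by (simp add: supports_def)
    then show ?thesis by (rule UnionI) (use g(2) in blast)
  qed
  have "det3 p q r * det3 p q r = 1"
    using facet_det pqr by (intro abs_eq_1_square) (auto simp: supports_def)
  then have u: "dot u p = 1" "dot u q = 0" "dot u r = 0" "dot u w = - 1"
    using neighbour_det[OF pqr w] by (simp_all add: u_def dot_ridge_dual det3_degenerate del: ridge_dual.simps)
  have new: "supports K m' {w, q, r}"
    unfolding m'_def u_def by (rule neighbour_supports[OF pqr w])
  have VC: "v \<in> set V \<union> set C" if "emb v \<in> \<Union>K" for v
    using subsetD[OF KVC that] inj_image_mem_iff[OF inj_emb] by blast
  show "w \<in> set (V @ C)" using VC[OF wK] by simp
  have "set unit_vecs \<subseteq> set (List.insert w V)" using es by auto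
  moreover have "emb ` set (List.insert w V) \<subseteq> \<Union>K" using wK VK by auto
  ultimately have "0 \<le> (\<Sum>v\<in>set (List.insert w V). height v)" by (rule sum_heights_nonneg)
  moreover have "distinct (List.insert w V)" using dist by simp
  ultimately have sum: "0 \<le> sum_list (map height (List.insert w V))"
    by (simp only: sum_list_distinct_conv_sum_set)
  have "beneath n g w" if "(n, g) \<in> set F" for n g
    using supports_le_0[OF supp[OF that] wK] by (cases "w \<in> set g") (simp_all add: beneath_def)
  moreover have "beneath m' [w, q, r] v" if "v \<in> set V" for v
    using supports_le_0[OF new VK[OF that]] by (cases "v \<in> {w, q, r}") (simp_all add: beneath_def)
  ultimately show "admissible V F (m, p, q, r) u w"
    using u(4) sum by (auto simp: admissible_def list_all_iff m'_def)
  show "vertex_invariant K (extend (V, F, E, C) m' w q r)"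
  proof -
    have split: "v \<in> set V \<or> v = w \<or> v \<in> set C \<and> dot m' v \<le> 0" if "emb v \<in> \<Union>K" for v
      using VC[OF that] supports_le_0[OF new that] fV by blast
    have "v \<in> set (List.insert w V) \<union> set (filter (\<lambda>v. if v = w then False else dot m' v \<le> 0) C)"
      if "v \<in> set V \<or> v = w \<or> v \<in> set C \<and> dot m' v \<le> 0" for v
      using that by (elim disjE conjE) simp_all
    with split have in_new: "v \<in> set (List.insert w V) \<union> set (filter (\<lambda>v. if v = w then False else dot m' v \<le> 0) C)"
      if "emb v \<in> \<Union>K" for v
      using that by blast
    have "\<Union>K \<subseteq> emb ` (set (List.insert w V) \<union> set (filter (\<lambda>v. if v = w then False else dot m' v \<le> 0) C))"
    proof
      fix x assume "x \<in> \<Union>K"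
      then obtain v where "x = emb v" "emb v \<in> \<Union>K" using emb_vertices by blast
      then show "x \<in> emb ` (set (List.insert w V) \<union> set (filter (\<lambda>v. if v = w then False else dot m' v \<le> 0) C))"
        using in_new by blast
    qed
    moreover have "\<forall>(n, g)\<in>set ((m', [w, q, r]) # F). supports K n (set g)" using supp new by auto
    moreover have "distinct (List.insert w V)" using dist by simp
    moreover have "set unit_vecs \<subseteq> set (List.insert w V)" using es by auto
    moreover have "set (List.insert w V) = \<Union>((\<lambda>x. set (snd x)) ` set ((m', [w, q, r]) # F))"
      using V fV by auto
    ultimately show ?thesis
      unfolding extend_def prod.case vertex_invariant.simps by blast
  qed
  show "ridge_invariant X (extend (V, F, E, C) m' w q r)"
  proof -
    let ?F = "(m', [w, q, r]) # F"
    let ?E = "filter (is_open ?F) (E @ [(m', q, w, r), (m', r, w, q)])"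
    have R1: "\<exists>f'. (n, f') \<in> set F \<and> set f' = {a, b, c}"
      if "(n, a, b, c) \<in> set E \<union> insert (m, p, q, r) X" for n a b c
      using bspec[OF conjunct1[OF ridges[unfolded ridge_invariant.simps]] that] by (simp only: prod.case)
    have R2: "(\<exists>(n, g)\<in>set F. v \<notin> set g \<and> set f' - {v} \<subseteq> set g) \<or>
        (\<exists>(n, a, b, c)\<in>set E \<union> insert (m, p, q, r) X. set f' = {a, b, c} \<and> v = a)"
      if "(n', f') \<in> set F" "v \<in> set f'" for n' f' v
    proof (rule bspec[of "set f'"])
      show "\<forall>v\<in>set f'. (\<exists>(n, g)\<in>set F. v \<notin> set g \<and> set f' - {v} \<subseteq> set g) \<or>
          (\<exists>(n, a, b, c)\<in>set E \<union> insert (m, p, q, r) X. set f' = {a, b, c} \<and> v = a)"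
        using bspec[OF conjunct2[OF ridges[unfolded ridge_invariant.simps]] that(1)] by (simp only: prod.case)
    qed (rule that(2))
    \<comment> \<open>A ridge is deleted from the list only if the updated facets contain a second facet through it.\<close>
    have crossed: "\<exists>(n, g)\<in>set ?F. a \<notin> set g \<and> {a, b, c} - {a} \<subseteq> set g"
      if "\<not> is_open ?F (n, a, b, c)" for n a b c
      using that by (fastforce split: if_splits)
    have closed: "(\<exists>(n, g)\<in>set ?F. v \<notin> set g \<and> set f' - {v} \<subseteq> set g) \<or>
        (\<exists>(n, a, b, c)\<in>set ?E \<union> X. set f' = {a, b, c} \<and> v = a)"
      if "set f' = {a, b, c}" "v = a" "(n, a, b, c) \<in> set (E @ [(m', q, w, r), (m', r, w, q)]) \<union> X"
      for f' v n a b c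
    proof (cases "(n, a, b, c) \<in> set ?E \<union> X")
      case True
      then show ?thesis using that(1,2) by (intro disjI2 bexI[of _ "(n, a, b, c)"]) simp_all
    next
      case False
      then have "\<not> is_open ?F (n, a, b, c)" using that(3) unfolding Un_iff set_filter mem_Collect_eq by blast
      from crossed[OF this] show ?thesis unfolding that(1,2) by (rule disjI1)
    qed
    have 1: "\<exists>f'. (n, f') \<in> set ?F \<and> set f' = {a, b, c}" if "(n, a, b, c) \<in> set ?E \<union> X" for n a b c
    proof -
      have "(n, a, b, c) \<in> set (E @ [(m', q, w, r), (m', r, w, q)]) \<union> X"
        using that unfolding set_filter by blast
      then have "(n, a, b, c) \<in> set E \<union> X \<or> (n, a, b, c) = (m', q, w, r) \<or> (n, a, b, c) = (m', r, w, q)"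
        by auto
      then show ?thesis
      proof (elim disjE)
        assume "(n, a, b, c) \<in> set E \<union> X"
        then have "\<exists>f'. (n, f') \<in> set F \<and> set f' = {a, b, c}" by (intro R1) blast
        then show ?thesis by (meson list.set_intros(2))
      next
        assume "(n, a, b, c) = (m', q, w, r)"
        then show ?thesis by (intro exI[of _ "[w, q, r]"]) auto
      next
        assume "(n, a, b, c) = (m', r, w, q)"
        then show ?thesis by (intro exI[of _ "[w, q, r]"]) auto
      qed
    qed
    have 2: "(\<exists>(n, g)\<in>set ?F. v \<notin> set g \<and> set f' - {v} \<subseteq> set g) \<or>
        (\<exists>(n, a, b, c)\<in>set ?E \<union> X. set f' = {a, b, c} \<and> v = a)"
      if nf': "(n', f') \<in> set ?F" and vf': "v \<in> set f'" for n' f' v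
    proof (cases "(n', f') \<in> set F")
      case True
      then consider n g where "(n, g) \<in> set F" "v \<notin> set g" "set f' - {v} \<subseteq> set g"
        | n a b c where "(n, a, b, c) \<in> set E \<union> insert (m, p, q, r) X" "set f' = {a, b, c}" "v = a"
        using R2[OF True vf'] by blast
      then show ?thesis
      proof cases
        case 1
        then show ?thesis by (intro disjI1 bexI[of _ "(n, g)"]) simp_all
      next
        case 2
        show ?thesis
        proof (cases "(n, a, b, c) = (m, p, q, r)")
          case True
          have "p \<noteq> q" "p \<noteq> r" using u by auto
          moreover have "p \<noteq> w" using w(2) by blast
          moreover have "v = p" "set f' = {p, q, r}" using 2(2,3) True by simp_all
          ultimately have "v \<notin> set [w, q, r]" "set f' - {v} \<subseteq> set [w, q, r]" by auto
          then show ?thesis by (intro disjI1 bexI[of _ "(m', [w, q, r])"]) simp_all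
        next
          case False
          then have "(n, a, b, c) \<in> set (E @ [(m', q, w, r), (m', r, w, q)]) \<union> X" using 2(1) by auto
          then show ?thesis by (rule closed[OF 2(2,3)])
        qed
      qed
    next
      case False
      then have f': "f' = [w, q, r]" using nf' by simp
      consider "v = w" | "v = q" | "v = r" using vf' f' by auto
      then show ?thesis
      proof cases
        case 1
        then have "v \<notin> set f" "set f' - {v} \<subseteq> set f" using f(2) f' w(2) by auto
        then show ?thesis using f(1) by (intro disjI1 bexI[of _ "(m, f)"]) simp_all
      next
        case 2
        have "set f' = {q, w, r}" using f' by auto
        then show ?thesis by (rule closed[OF _ 2, where n = m']) simp
      next
        case 3
        have "set f' = {r, w, q}" using f' by auto
        then show ?thesis by (rule closed[OF _ 3, where n = m']) simp
      qed
    qed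
    show ?thesis
      unfolding extend_def prod.case ridge_invariant.simps
    proof (intro conjI ballI)
      fix \<rho> assume "\<rho> \<in> set ?E \<union> X"
      moreover obtain n a b c where "\<rho> = (n, a, b, c)" by (cases \<rho>)
      ultimately show "case \<rho> of (n, a, b, c) \<Rightarrow> \<exists>f'. (n, f') \<in> set ?F \<and> set f' = {a, b, c}"
        using 1 by (simp only: prod.case)
    next
      fix \<phi> assume "\<phi> \<in> set ?F"
      moreover obtain n' f' where "\<phi> = (n', f')" by (cases \<phi>)
      ultimately show "case \<phi> of (n', f') \<Rightarrow> \<forall>v\<in>set f'.
          (\<exists>(n, g)\<in>set ?F. v \<notin> set g \<and> set f' - {v} \<subseteq> set g) \<or>
          (\<exists>(n, a, b, c)\<in>set ?E \<union> X. set f' = {a, b, c} \<and> v = a)"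
        using 2 by (simp only: prod.case) blast
    qed
  qed
qed

lemma branch_sound:
  assumes inv: "vertex_invariant K (V, F, E, C)" and ridges: "ridge_invariant (insert (m, p, q, r) X) (V, F, E, C)"
    and w: "emb ` {w, q, r} \<in> K" "w \<notin> {p, q, r}" "height w \<le> h"
    and b: "branch h k (V, F, E, C) (m, p, q, r) (ridge_dual (m, p, q, r))"
  obtains st where "k w st" "vertex_invariant K st" "ridge_invariant X st"
proof -
  note e = extend_sound[OF inv ridges w(1,2)]
  have "list_all (\<lambda>w. if height w \<le> h then if admissible V F (m, p, q, r) (ridge_dual (m, p, q, r)) w then
      k w (extend (V, F, E, C) (add m (scale (dot m w - 1) (ridge_dual (m, p, q, r)))) w q r) else True else True) (V @ C)"
    using b unfolding branch_def prod.case .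
  then have "k w (extend (V, F, E, C) (add m (scale (dot m w - 1) (ridge_dual (m, p, q, r)))) w q r)"
    using e(1,2) w(3) unfolding list_all_iff by (metis (no_types, lifting))
  then show ?thesis using that e(3,4) by blast
qed

text \<open>When no ridge is open the facets found so far are closed under neighbours, hence all facets.\<close>

lemma search_sound:
  assumes "search n st" "vertex_invariant K st" "ridge_invariant {} st"
  shows "\<exists>G. complex_of G = K \<and> reducible G"
  using assms
proof (induction n arbitrary: st)
  case (Suc n)
  obtain V F E C where st: "st = (V, F, E, C)" by (cases st)
  note inv = Suc.prems(2)[unfolded st] and ridges = Suc.prems(3)[unfolded st]
  show ?case
  proof (cases E)
    case Nil
    have supp: "supports K m (set f)" if "(m, f) \<in> set F" for m f using inv that by auto
    have closed: "\<exists>(n, g)\<in>set F. v \<notin> set g \<and> set f - {v} \<subseteq> set g" if "(m, f) \<in> set F" "v \<in> set f" for m f v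
      using ridges that unfolding Nil ridge_invariant.simps by fastforce
    have "complex_of (map snd F) = K"
    proof (rule fano_subcomplex_eq[OF K])
      show "complex_of (map snd F) \<subseteq> K" using supp by (fastforce simp: complex_of_def supports_def)
      have "F \<noteq> []" using inv by (auto simp: unit_vecs_def)
      then show "complex_of (map snd F) \<noteq> {}" by (simp add: complex_of_def)
      fix S x assume "S \<in> complex_of (map snd F)" "x \<in> S"
      then obtain m f v where f: "(m, f) \<in> set F" "S = emb ` set f" "x = emb v" "v \<in> set f"
        by (auto simp: complex_of_def)
      obtain n g where g: "(n, g) \<in> set F" "v \<notin> set g" "set f - {v} \<subseteq> set g" using closed[OF f(1,4)] by blast
      have "S \<inter> emb ` set g = emb ` (set f \<inter> set g)" unfolding f(2) by (simp add: image_Int[OF inj_emb])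
      also have "set f \<inter> set g = set f - {v}" using g by blast
      also have "emb ` (set f - {v}) = S - {x}" unfolding f(2,3) by (simp add: image_set_diff[OF inj_emb])
      finally have "S \<inter> emb ` set g = S - {x}" .
      moreover have "emb ` set g \<in> complex_of (map snd F)" using g(1) by (force simp: complex_of_def)
      ultimately show "\<exists>S'\<in>complex_of (map snd F). S \<inter> S' = S - {x}" by blast
    qed
    moreover have "reducible (map snd F)" using Suc.prems(1) by (simp add: st Nil)
    ultimately show ?thesis by blast
  next
    case (Cons \<rho> E')
    obtain m p q r where \<rho>: "\<rho> = (m, p, q, r)" by (cases \<rho>)
    have inv': "vertex_invariant K (V, F, E', C)" using inv unfolding vertex_invariant.simps .
    have E: "set E \<union> {} = set E' \<union> insert (m, p, q, r) {}" unfolding Cons \<rho> by auto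
    have ridges': "ridge_invariant (insert (m, p, q, r) {}) (V, F, E', C)"
      using ridges unfolding ridge_invariant.simps E .
    obtain f where f: "(m, f) \<in> set F" "set f = {p, q, r}" using ridges' by auto
    then have "supports K m (set f)" using inv' by auto
    then have "emb ` {p, q, r} \<in> K" unfolding supports_def f(2) by (rule conjunct1)
    then obtain w where w: "emb ` {w, q, r} \<in> K" "w \<notin> {p, q, r}" by (rule facet_neighbour)
    have "emb w \<in> \<Union>K" by (rule UnionI[OF w(1)]) simp
    then have h: "height w \<le> 1" by (rule height_le_1)
    have b: "branch 1 (\<lambda>w. search n) (V, F, E', C) (m, p, q, r) (ridge_dual (m, p, q, r))"
      using Suc.prems(1) by (simp add: st Cons \<rho> del: ridge_dual.simps)
    obtain st' where "search n st'" "vertex_invariant K st'" "ridge_invariant {} st'"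
      by (rule branch_sound[OF inv' ridges' w h b])
    then show ?thesis by (rule Suc.IH)
  qed
qed simp

text \<open>The first three steps of the search take the unit vectors as labelled so that the heights of their
  opposite vertices decrease.\<close>

lemma enumeration_sound:
  assumes enumeration: enumeration
    and cand: "\<And>v. emb v \<in> \<Union>K \<Longrightarrow> v \<notin> set unit_vecs \<Longrightarrow> v \<in> set candidates"
    and w1: "emb ` {w1, (0,1,0), (0,0,1)} \<in> K" "w1 \<notin> set unit_vecs"
    and w2: "emb ` {w2, (1,0,0), (0,0,1)} \<in> K" "w2 \<notin> set unit_vecs"
    and w3: "emb ` {w3, (1,0,0), (0,1,0)} \<in> K" "w3 \<notin> set unit_vecs"
    and sorted: "height w2 \<le> height w1" "height w3 \<le> height w2"
  shows "\<exists>G. complex_of G = K \<and> reducible G"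
proof -
  define \<rho>1 \<rho>2 \<rho>3 :: ridge where
    "\<rho>1 = ((1,1,1), (1,0,0), (0,1,0), (0,0,1))" and "\<rho>2 = ((1,1,1), (0,1,0), (1,0,0), (0,0,1))"
    and "\<rho>3 = ((1,1,1), (0,0,1), (1,0,0), (0,1,0))"
  have dual: "ridge_dual \<rho>1 = (1,0,0)" "ridge_dual \<rho>2 = (0,1,0)" "ridge_dual \<rho>3 = (0,0,1)"
    by (simp_all add: \<rho>1_def \<rho>2_def \<rho>3_def det3_def)
  let ?s0 = "(unit_vecs, [((1,1,1), unit_vecs)], [], candidates) :: state"
  have base: "supports K (1,1,1) (set unit_vecs)" using heights by (simp add: heights_ok_def)
  have "\<Union>K \<subseteq> emb ` (set unit_vecs \<union> set candidates)" using cand emb_vertices by blast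
  then have inv0: "vertex_invariant K ?s0" using base by (simp add: unit_vecs_def)
  have r0: "ridge_invariant (insert \<rho>1 {\<rho>2, \<rho>3}) ?s0"
    by (simp add: \<rho>1_def \<rho>2_def \<rho>3_def unit_vecs_def) auto
  have "emb w1 \<in> \<Union>K" by (rule UnionI[OF w1(1)]) simp
  then have h: "height w1 \<le> 1" by (rule height_le_1)
  have b: "branch 1 (\<lambda>w1 s1. branch (height w1) (\<lambda>w2 s2. branch (height w2) (\<lambda>w3 s3. search 20 s3)
      s2 \<rho>3 (ridge_dual \<rho>3)) s1 \<rho>2 (ridge_dual \<rho>2)) ?s0 \<rho>1 (ridge_dual \<rho>1)"
    using enumeration unfolding dual unfolding enumeration_def \<rho>1_def \<rho>2_def \<rho>3_def unit_vecs_def .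
  obtain s1 where s1: "branch (height w1) (\<lambda>w2 s2. branch (height w2) (\<lambda>w3 s3. search 20 s3)
      s2 \<rho>3 (ridge_dual \<rho>3)) s1 \<rho>2 (ridge_dual \<rho>2)"
      "vertex_invariant K s1" "ridge_invariant (insert \<rho>2 {\<rho>3}) s1"
    by (rule branch_sound[OF inv0 r0[unfolded \<rho>1_def] w1(1) _ h b[unfolded \<rho>1_def]])
      (use w1(2) in \<open>auto simp: unit_vecs_def\<close>)
  obtain V1 F1 E1 C1 where t1: "s1 = (V1, F1, E1, C1)" by (cases s1)
  obtain s2 where s2: "branch (height w2) (\<lambda>w3 s3. search 20 s3) s2 \<rho>3 (ridge_dual \<rho>3)"
      "vertex_invariant K s2" "ridge_invariant (insert \<rho>3 {}) s2"
    by (rule branch_sound[OF s1(2,3)[unfolded t1 \<rho>2_def] w2(1) _ sorted(1) s1(1)[unfolded t1 \<rho>2_def]])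
      (use w2(2) in \<open>auto simp: unit_vecs_def\<close>)
  obtain V2 F2 E2 C2 where t2: "s2 = (V2, F2, E2, C2)" by (cases s2)
  obtain s3 where "search 20 s3" "vertex_invariant K s3" "ridge_invariant {} s3"
    by (rule branch_sound[OF s2(2,3)[unfolded t2 \<rho>3_def] w3(1) _ sorted(2) s2(1)[unfolded t2 \<rho>3_def]])
      (use w3(2) in \<open>auto simp: unit_vecs_def\<close>)
  then show ?thesis by (rule search_sound)
qed

end

end

text \<open>A vertex of height less than \<open>-3\<close> would make the total height negative. For the lower bound on a
  coordinate, evaluate the normal \<open>m + (m \<cdot> w - 1) u\<close> of the neighbouring facet at the vertex: the value
  is at most one while \<open>m \<cdot> w \<le> 0\<close>.\<close>

lemma vertex_in_candidates:
  assumes K: "fano_complex K" and heights: "heights_ok K"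
    and v: "emb v \<in> \<Union>K" "v \<notin> set unit_vecs"
  shows "v \<in> set candidates"
proof -
  obtain x y z where xyz: "v = (x, y, z)" by (cases v)
  define h where "h = height v"
  have base: "supports K (1,1,1) (set unit_vecs)" using heights by (simp add: heights_ok_def)
  have h0: "h \<le> 0" using supports_le_0[OF K base v] by (simp add: h_def height_eq_dot)
  have unitsK: "emb ` set unit_vecs \<in> K" using base by (simp add: supports_def)
  have "0 \<le> (\<Sum>u\<in>insert v (set unit_vecs). height u)"
    by (rule sum_heights_nonneg[OF K heights]) (use v(1) unitsK in blast)+
  also have "\<dots> = h + 3" using v(2) by (simp add: h_def unit_vecs_def)
  finally have h3: "- 3 \<le> h" by simp
  have coord: "h - 1 \<le> dot (ridge_dual (m, p, q, r)) v"
    if "m = (1,1,1)" "{p, q, r} = set unit_vecs" for m p q r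
  proof -
    let ?u = "ridge_dual (m, p, q, r)"
    have m: "supports K m {p, q, r}" using base that by simp
    then have "emb ` {p, q, r} \<in> K" by (simp add: supports_def)
    then obtain w where w: "emb ` {w, q, r} \<in> K" "w \<notin> {p, q, r}" by (rule facet_neighbour[OF K])
    have wK: "emb w \<in> \<Union>K" by (rule UnionI[OF w(1)]) simp
    have k: "dot m w \<le> 0" by (rule supports_le_0[OF K m wK w(2)])
    have "dot (add m (scale (dot m w - 1) ?u)) v \<le> 1"
      by (rule supports_le_1[OF K neighbour_supports[OF K m w] v(1)])
    then have *: "h + (dot m w - 1) * dot ?u v \<le> 1"
      using that(1) by (simp add: dot_add dot_scale h_def height_eq_dot del: ridge_dual.simps)
    show ?thesis
    proof (rule ccontr)
      assume "\<not> h - 1 \<le> dot ?u v"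
      moreover from this have "(1 - dot m w) * dot ?u v \<le> 1 * dot ?u v"
        using k h0 by (intro mult_right_mono_neg) auto
      ultimately show False using * by (simp add: algebra_simps)
    qed
  qed
  have "h - 1 \<le> x" "h - 1 \<le> y" "h - 1 \<le> z"
    using coord[OF refl, of "(1,0,0)" "(0,1,0)" "(0,0,1)"] coord[OF refl, of "(0,1,0)" "(1,0,0)" "(0,0,1)"]
      coord[OF refl, of "(0,0,1)" "(1,0,0)" "(0,1,0)"]
    by (auto simp: xyz unit_vecs_def det3_def)
  moreover have "z = h - x - y" by (simp add: h_def xyz)
  moreover have "h \<in> set [0,-1,-2,-3]" using h0 h3 by auto
  ultimately have "v = (x, y, h - x - y)" "h \<in> set [0,-1,-2,-3]" "x \<in> set [h-1..2-h]"
    "y \<in> set (filter (\<lambda>y. h - 1 \<le> h - x - y) [h-1..2-h])"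
    unfolding xyz set_filter set_upto by auto
  then show ?thesis
    unfolding candidates_def set_concat set_map image_image UN_iff by (intro bexI[of _ h] bexI[of _ x]) auto
qed

section \<open>Coordinates at a special facet\<close>

lemma ordered_triple:
  fixes g :: "'a \<Rightarrow> real"
  assumes "card S = 3"
  obtains a b c where "S = {a, b, c}" "a \<noteq> b" "a \<noteq> c" "b \<noteq> c" "g b \<le> g a" "g c \<le> g b"
proof -
  obtain x y z where S: "S = {x, y, z}" "x \<noteq> y" "y \<noteq> z" "x \<noteq> z" using assms by (auto simp: card_3_iff)
  have perms: "S = {x, z, y}" "S = {y, x, z}" "S = {y, z, x}" "S = {z, x, y}" "S = {z, y, x}" using S(1) by auto
  consider "g y \<le> g x" "g z \<le> g y" | "g z \<le> g x" "g y \<le> g z" | "g x \<le> g y" "g z \<le> g x"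
    | "g z \<le> g y" "g x \<le> g z" | "g x \<le> g z" "g y \<le> g x" | "g y \<le> g z" "g x \<le> g y"
    by linarith
  then show ?thesis
    by cases (use that S perms in \<open>metis\<close>)+
qed

text \<open>The cone of some facet contains the sum of all vertices. This facet is moved to the unit vectors, ordered
  by the heights of the opposite vertices.\<close>

lemma special_coordinates:
  fixes K :: "(real^3) set set"
  assumes K: "fano_complex K"
  obtains f w1 w2 w3 where "linear f" "bij f" "f ` std_lattice = std_lattice"
    "heights_ok ((\<lambda>S. f ` S) ` K)"
    "emb ` {w1, (0,1,0), (0,0,1)} \<in> (\<lambda>S. f ` S) ` K" "w1 \<notin> set unit_vecs"
    "emb ` {w2, (1,0,0), (0,0,1)} \<in> (\<lambda>S. f ` S) ` K" "w2 \<notin> set unit_vecs"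
    "emb ` {w3, (1,0,0), (0,1,0)} \<in> (\<lambda>S. f ` S) ` K" "w3 \<notin> set unit_vecs"
    "height w2 \<le> height w1" "height w3 \<le> height w2"
proof -
  obtain S where S: "S \<in> K" "\<Sum>(\<Union>K) \<in> convex_cone hull S" by (rule complex_covers[OF K])
  note B = complex_basis[OF K S(1)]
  let ?n = "facet_normal S"
  have special: "0 \<le> (\<Sum>v\<in>\<Union>K. ?n \<bullet> v)"
    using complex_normal_nonneg_on_cone[OF K S] by (simp add: inner_sum_right)
  have "\<forall>v\<in>S. \<exists>w. w \<notin> S \<and> insert w (S - {v}) \<in> K"
    using complex_neighbour_vertex[OF K S(1)] by metis
  then obtain opp where opp: "\<And>v. v \<in> S \<Longrightarrow> opp v \<notin> S \<and> insert (opp v) (S - {v}) \<in> K" by metis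
  have "card S = 3" using lattice_basis_card[OF B] by simp
  then obtain a b c where abc: "S = {a, b, c}" "a \<noteq> b" "a \<noteq> c" "b \<noteq> c"
    and sorted: "?n \<bullet> opp b \<le> ?n \<bullet> opp a" "?n \<bullet> opp c \<le> ?n \<bullet> opp b"
    by (rule ordered_triple[of S "\<lambda>v. ?n \<bullet> opp v"])
  have U: "lattice_basis (emb ` set unit_vecs)"
    using unimodular_imp_lattice_basis[of "(1,0,0)" "(0,1,0)" "(0,0,1)"] by (simp add: det3_def unit_vecs_def)
  define h where "h = (\<lambda>v. if v = a then emb (1,0,0) else if v = b then emb (0,1,0) else emb (0,0,1))"
  have h: "h a = emb (1,0,0)" "h b = emb (0,1,0)" "h c = emb (0,0,1)" using abc by (auto simp: h_def)
  have "bij_betw h S (emb ` set unit_vecs)"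
    unfolding bij_betw_def abc(1) inj_on_def using h by (simp add: unit_vecs_def)
  then obtain f where f: "linear f" "bij f" "f ` std_lattice = std_lattice" and fh: "\<And>v. v \<in> S \<Longrightarrow> f v = h v"
    using lattice_basis_map[OF B U] by metis
  have fabc: "f a = emb (1,0,0)" "f b = emb (0,1,0)" "f c = emb (0,0,1)" using fh h abc(1) by auto
  have fS: "f ` S = emb ` set unit_vecs" using fabc abc(1) by (simp add: unit_vecs_def)
  have inj: "inj f" using f(2) by (rule bij_is_inj)
  let ?K = "(\<lambda>S. f ` S) ` K"
  have K': "fano_complex ?K" by (rule fano_complex_image[OF f K])
  have fSK: "emb ` set unit_vecs \<in> ?K" using S(1) fS by (metis imageI)
  have base: "supports ?K (1,1,1) (set unit_vecs)" using fSK by (auto simp: supports_def unit_vecs_def)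
  have "facet_normal (emb ` set unit_vecs) = emb (1,1,1)"
    using U by (intro facet_normal_emb) (auto simp: unit_vecs_def)
  then have n: "emb (1,1,1) \<bullet> f x = ?n \<bullet> x" for x
    using facet_normal_image[OF f B] fS by simp
  have height_n: "of_int (height v) = ?n \<bullet> x" if "emb v = f x" for v x
    using n[of x] that by (metis emb_inner height_eq_dot)
  have "real_of_int (\<Sum>v | emb v \<in> \<Union>?K. height v) = (\<Sum>v | emb v \<in> \<Union>?K. emb (1,1,1) \<bullet> emb v)"
    by (simp only: of_int_sum emb_inner height_eq_dot)
  also have "\<dots> = (\<Sum>y\<in>emb ` {v. emb v \<in> \<Union>?K}. emb (1,1,1) \<bullet> y)"
    by (subst sum.reindex) (auto intro: inj_on_subset[OF inj_emb])
  also have "emb ` {v. emb v \<in> \<Union>?K} = f ` \<Union>K"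
    by (rule trans[OF emb_vertices[OF K', symmetric]]) blast
  also have "(\<Sum>y\<in>f ` \<Union>K. emb (1,1,1) \<bullet> y) = (\<Sum>x\<in>\<Union>K. ?n \<bullet> x)"
    by (subst sum.reindex) (auto intro: inj_on_subset[OF inj] simp: n)
  finally have "real_of_int 0 \<le> real_of_int (\<Sum>v | emb v \<in> \<Union>?K. height v)"
    using special by (simp only: of_int_0)
  then have "0 \<le> (\<Sum>v | emb v \<in> \<Union>?K. height v)" unfolding of_int_le_iff .
  then have heights: "heights_ok ?K" using base by (simp add: heights_ok_def)
  have opposite: "\<exists>w. emb w = f (opp v) \<and> emb ` insert w (set unit_vecs - {e}) \<in> ?K \<and> w \<notin> set unit_vecs"
    if v: "v \<in> S" "f v = emb e" for v e
  proof -
    have o: "opp v \<notin> S" "insert (opp v) (S - {v}) \<in> K" using opp[OF v(1)] by auto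
    then have "f (opp v) \<in> \<Union>?K" by blast
    then have "f (opp v) \<in> emb ` {v. emb v \<in> \<Union>?K}" by (subst emb_vertices[OF K', symmetric])
    then obtain w where w: "emb w = f (opp v)" by (auto simp del: Union_iff)
    have "f ` insert (opp v) (S - {v}) = insert (f (opp v)) (f ` S - {f v})"
      using inj by (simp add: image_set_diff)
    also have "\<dots> = emb ` insert w (set unit_vecs - {e})"
      unfolding fS v(2) w[symmetric] by (simp add: image_set_diff[OF inj_emb])
    finally have eq: "f ` insert (opp v) (S - {v}) = emb ` insert w (set unit_vecs - {e})" .
    have "emb ` insert w (set unit_vecs - {e}) \<in> ?K" using imageI[OF o(2), of "\<lambda>S. f ` S"] unfolding eq .
    moreover have "f (opp v) \<notin> f ` S" using o(1) inj by (simp add: inj_image_mem_iff)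
    then have "w \<notin> set unit_vecs" unfolding fS w[symmetric] by blast
    ultimately show ?thesis using w by blast
  qed
  obtain w1 where w1: "emb w1 = f (opp a)" "emb ` insert w1 (set unit_vecs - {(1,0,0)}) \<in> ?K" "w1 \<notin> set unit_vecs"
    using opposite[of a] fabc abc(1) by blast
  obtain w2 where w2: "emb w2 = f (opp b)" "emb ` insert w2 (set unit_vecs - {(0,1,0)}) \<in> ?K" "w2 \<notin> set unit_vecs"
    using opposite[of b] fabc abc(1) by blast
  obtain w3 where w3: "emb w3 = f (opp c)" "emb ` insert w3 (set unit_vecs - {(0,0,1)}) \<in> ?K" "w3 \<notin> set unit_vecs"
    using opposite[of c] fabc abc(1) by blast
  have units: "set unit_vecs - {(1,0,0)} = {(0,1,0), (0,0,1)}" "set unit_vecs - {(0,1,0)} = {(1,0,0), (0,0,1)}"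
    "set unit_vecs - {(0,0,1)} = {(1,0,0), (0,1,0)}" by (auto simp: unit_vecs_def)
  have "height w2 \<le> height w1" "height w3 \<le> height w2"
    using sorted height_n[OF w1(1)] height_n[OF w2(1)] height_n[OF w3(1)] by linarith+
  then show ?thesis
    by (rule that[OF f heights w1(2)[unfolded units(1)] w1(3) w2(2)[unfolded units(2)] w2(3)
          w3(2)[unfolded units(3)] w3(3)])
qed

section \<open>Projective space and the induction\<close>

lemma projective_space_gens_3:
  "(projective_space_gens :: (real^3) set) = emb ` {(1,0,0), (0,1,0), (0,0,1), (-1,-1,-1)}"
proof -
  have axes: "axis 1 1 = emb (1,0,0)" "axis 2 1 = emb (0,1,0)" "axis 3 1 = emb (0,0,1)"
    "- (\<Sum>i\<in>UNIV. axis i 1) = emb (-1,-1,-1)"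
    by (simp_all add: vec_eq_iff forall_3 emb_nth axis_def sum_3)
  have "range (\<lambda>i. axis i 1 :: real^3) = {emb (1,0,0), emb (0,1,0), emb (0,0,1)}"
    unfolding UNIV_3 image_insert image_empty axes(1-3) ..
  then show ?thesis
    unfolding projective_space_gens_def axes(4) by auto
qed

text \<open>The proper subsets of the generators are the subsets of the complements of single generators.\<close>

lemma fan_of_simplex_boundary: "fan_of (complex_of simplex_boundary) = projective_space_fan"
proof -
  let ?A = "{(1,0,0), (0,1,0), (0,0,1), (-1,-1,-1)} :: vec set"
  have facets: "set ` set simplex_boundary = (\<lambda>g. ?A - {g}) ` ?A"
  proof -
    have rotate: "{a, b, c, d} = {b, c, d, a}" for a b c d :: "vec set" by blast
    have "?A - {(1,0,0)} = {(-1,-1,-1), (0,1,0), (0,0,1)}" "?A - {(0,1,0)} = {(1,0,0), (-1,-1,-1), (0,0,1)}"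
      "?A - {(0,0,1)} = {(1,0,0), (0,1,0), (-1,-1,-1)}" "?A - {(-1,-1,-1)} = {(1,0,0), (0,1,0), (0,0,1)}"
      by auto
    then show ?thesis
      unfolding simplex_boundary_def list.set image_insert image_empty by (simp only: rotate)
  qed
  have "complex_of simplex_boundary = (\<lambda>A. emb ` A) ` set ` set simplex_boundary" by (simp add: complex_of_def image_image)
  also have "\<dots> = (\<lambda>g. emb ` ?A - {emb g}) ` ?A"
    unfolding facets by (simp only: image_image image_set_diff[OF inj_emb] image_insert image_empty)
  also have "\<dots> = (\<lambda>x. projective_space_gens - {x}) ` projective_space_gens"
    unfolding projective_space_gens_3 by (simp only: image_image)
  finally have facets: "complex_of simplex_boundary = (\<lambda>x. projective_space_gens - {x}) ` projective_space_gens" .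
  have proper: "T \<subset> G \<longleftrightarrow> (\<exists>S. T \<subseteq> S \<and> S \<in> (\<lambda>x. G - {x}) ` G)" for T G :: "(real^3) set" by blast
  show ?thesis
    unfolding fan_of_def projective_space_fan_def facets proper by (rule Collect_cong) metis
qed

text \<open>By induction on the number of vertices: in special coordinates the enumeration finds the complex, and its
  moves lead to the simplex or to a complex with fewer vertices.\<close>

theorem fano_complex_F_equivalent_projective_space:
  fixes K :: "(real^3) set set"
  assumes "fano_complex K"
  shows "F_equivalent (fan_of K) projective_space_fan"
  using assms
proof (induction "card (\<Union>K)" arbitrary: K rule: less_induct)
  case less
  obtain f w1 w2 w3 where f: "linear f" "bij f" "f ` std_lattice = std_lattice"
    and heights: "heights_ok ((\<lambda>S. f ` S) ` K)"
    and w: "emb ` {w1, (0,1,0), (0,0,1)} \<in> (\<lambda>S. f ` S) ` K" "w1 \<notin> set unit_vecs"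
      "emb ` {w2, (1,0,0), (0,0,1)} \<in> (\<lambda>S. f ` S) ` K" "w2 \<notin> set unit_vecs"
      "emb ` {w3, (1,0,0), (0,1,0)} \<in> (\<lambda>S. f ` S) ` K" "w3 \<notin> set unit_vecs"
      "height w2 \<le> height w1" "height w3 \<le> height w2"
    by (rule special_coordinates[OF less.prems])
  let ?K = "(\<lambda>S. f ` S) ` K"
  have K': "fano_complex ?K" by (rule fano_complex_image[OF f less.prems])
  have "\<exists>G. complex_of G = ?K \<and> reducible G"
    by (rule enumeration_sound[OF K' heights enumeration_succeeds vertex_in_candidates[OF K' heights] w])
  then obtain G where G: "complex_of G = ?K" "reducible G" by blast
  have "\<Union>?K = f ` \<Union>K" by blast
  then have "card (\<Union>?K) = card (\<Union>K)"
    using card_image[OF inj_on_subset[OF bij_is_inj[OF f(2)]]] by simp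
  then have card: "length (verts G) = card (\<Union>K)" using card_vertices_complex_of[of G] G(1) by simp
  have "F_equivalent (fan_of ?K) projective_space_fan"
  proof (cases "length G = 4")
    case True
    then have "same G simplex_boundary" using G(2) by (simp add: reducible_def)
    then have "fan_of ?K = projective_space_fan"
      using same_imp_complex_of_eq G(1) fan_of_simplex_boundary by metis
    then show ?thesis using F_equivalent_refl nonsingular_toric_fano_fan_of[OF K'] by metis
  next
    case False
    then obtain ms where ms: "reduces (length (verts G)) ms G" using G(2) by (auto simp: reducible_def)
    have "fano_complex (complex_of G)" using K' unfolding G(1) .
    from reduces_F_equivalent[OF ms this] obtain H where H: "fano_complex (complex_of H)" "length (verts H) < length (verts G)"
      "\<And>X. F_equivalent (fan_of (complex_of H)) X \<Longrightarrow> F_equivalent (fan_of (complex_of G)) X"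
      by blast
    have "card (\<Union>(complex_of H)) < card (\<Union>K)" using H(2) card card_vertices_complex_of by simp
    then have "F_equivalent (fan_of (complex_of H)) projective_space_fan" using less.hyps H(1) by blast
    then show ?thesis using H(3) G(1) by simp
  qed
  then show ?case by (rule F_equivalent_image[OF f less.prems])
qed

theorem theorem7p1:
  shows "(\<forall>\<Sigma> :: (real^3) set set. nonsingular_toric_fano \<Sigma> \<longrightarrow>
            F_equivalent \<Sigma> projective_space_fan) \<and>
         (\<forall>\<Sigma> :: (real^3) set set. nonsingular_toric_fano \<Sigma> \<longrightarrow>
            pseudo_symmetric \<Sigma> \<or> F_equivalent \<Sigma> projective_space_fan)"
  by (metis nonsingular_toric_fano_complex fano_complex_F_equivalent_projective_space)

end
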